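(* Let $\mathfrak g$ be a finite dimensional semisimple Lie algebra, and let $(U\mathfrak g[[h]],\hat\Delta_h,\mathcal R_h)$ be a quasitriangular deformation of $(U\mathfrak g,\hat\Delta)$. Assume $\mathcal E\in(U\mathfrak g\otimes U\mathfrak g)[[h]]$ is a symmetric invariant $2$-cocycle such that $\mathcal E=1\mod h$, that is, (i) $[\mathcal E,\hat\Delta_h(a)]=0$ for all $a\in U\mathfrak g[[h]]$; (ii) $\mathcal R_h\mathcal E=\mathcal E_{21}\mathcal R_h$; (iii) $(\mathcal E\otimes1)(\hat\Delta_h\otimes\iota)(\mathcal E)=(1\otimes\mathcal E)(\iota\otimes\hat\Delta_h)(\mathcal E)$. Then there exists a central element $c\in U\mathfrak g[[h]]$ such that $c=1\mod h$ and $\mathcal E=(c\otimes c)\hat\Delta_h(c)^{-1}$.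
   Context: $\mathfrak g$ is a Lie algebra over $\mathbb C$, $U\mathfrak g$ its universal enveloping algebra with the usual coproduct $\hat\Delta$ ($\hat\Delta(x)=x\otimes1+1\otimes x$ for $x\in\mathfrak g$). A quasitriangular deformation $(U\mathfrak g[[h]],\hat\Delta_h,\mathcal R_h)$ of $(U\mathfrak g,\hat\Delta)$ means: the algebra $U\mathfrak g[[h]]$ of formal power series with its undeformed product, with a coassociative counital $\mathbb C[[h]]$-linear coproduct $\hat\Delta_h:U\mathfrak g[[h]]\to(U\mathfrak g\otimes U\mathfrak g)[[h]]$ (an algebra homomorphism) and a universal $R$-matrix $\mathcal R_h\in(U\mathfrak g\otimes U\mathfrak g)[[h]]$ making it a (topological) quasitriangular bialgebra over $\mathbb C[[h]]$, such that $\hat\Delta_h=\hat\Delta$ and $\mathcal R_h=1$ modulo $h$. $\mathcal E_{21}$ is $\mathcal E$ with the two tensor factors flipped and $\iota$ is the identity map. *)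

theory Defs
  imports
    Complex_Main
    "HOL-Library.Poly_Mapping"
    "HOL-Computational_Algebra.Formal_Power_Series"
begin

unbundle fps_syntax

section \<open>Complex vector spaces and algebras\<close>

class complex_vector = ab_group_add +
  fixes scaleC :: "complex \<Rightarrow> 'a \<Rightarrow> 'a" (infixr \<open>*\<^sub>C\<close> 74)
  assumes scaleC_add_right: "c *\<^sub>C (x + y) = c *\<^sub>C x + c *\<^sub>C y"
    and scaleC_add_left: "(c + d) *\<^sub>C x = c *\<^sub>C x + d *\<^sub>C x"
    and scaleC_scaleC: "c *\<^sub>C (d *\<^sub>C x) = (c * d) *\<^sub>C x"
    and scaleC_one: "1 *\<^sub>C x = x"

global_interpretation complex_vector: vector_space "scaleC :: complex \<Rightarrow> 'a \<Rightarrow> 'a::complex_vector"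
  by unfold_locales (fact scaleC_add_right scaleC_add_left scaleC_scaleC scaleC_one)+

abbreviation clinear :: "('a::complex_vector \<Rightarrow> 'b::complex_vector) \<Rightarrow> bool"
  where "clinear \<equiv> Vector_Spaces.linear scaleC scaleC"

definition cbilinear :: "('a::complex_vector \<Rightarrow> 'b::complex_vector \<Rightarrow> 'c::complex_vector) \<Rightarrow> bool"
  where "cbilinear f \<longleftrightarrow> (\<forall>a. clinear (f a)) \<and> (\<forall>b. clinear (\<lambda>a. f a b))"

definition finite_dimensional :: "'a::complex_vector itself \<Rightarrow> bool"
  where "finite_dimensional _ \<longleftrightarrow> (\<exists>B::'a set. finite B \<and> complex_vector.span B = UNIV)"

class complex_algebra_1 = complex_vector + ring_1 +
  assumes mult_scaleC_left: "(c *\<^sub>C x) * y = c *\<^sub>C (x * y)"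
    and mult_scaleC_right: "x * (c *\<^sub>C y) = c *\<^sub>C (x * y)"

definition algebra_hom :: "('a::complex_algebra_1 \<Rightarrow> 'b::complex_algebra_1) \<Rightarrow> bool"
  where "algebra_hom f \<longleftrightarrow> clinear f \<and> f 1 = 1 \<and> (\<forall>a b. f (a * b) = f a * f b)"

lemma clinearI:
  assumes "\<And>x y. f (x + y) = f x + f y" "\<And>c x. f (c *\<^sub>C x) = c *\<^sub>C f x"
  shows "clinear f"
  by unfold_locales (use assms in auto)

lemma
  assumes "clinear f"
  shows clinear_add: "f (x + y) = f x + f y"
    and clinear_scaleC: "f (c *\<^sub>C x) = c *\<^sub>C f x"
    and clinear_0: "f 0 = 0"
    and clinear_minus: "f (- x) = - f x"
    and clinear_diff: "f (x - y) = f x - f y"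
    and clinear_sum: "f (sum g A) = (\<Sum>a\<in>A. f (g a))"
proof -
  interpret Vector_Spaces.linear scaleC scaleC f by fact
  show "f (x + y) = f x + f y" "f (c *\<^sub>C x) = c *\<^sub>C f x" "f 0 = 0" "f (- x) = - f x"
    "f (x - y) = f x - f y" "f (sum g A) = (\<Sum>a\<in>A. f (g a))"
    by (simp_all add: add scale neg diff sum)
qed

lemma clinear_compose: "clinear f \<Longrightarrow> clinear g \<Longrightarrow> clinear (\<lambda>x. g (f x))"
  by (rule clinearI) (simp_all add: clinear_add clinear_scaleC)

lemma clinear_ident: "clinear (\<lambda>x. x)"
  by (rule clinearI) auto

lemma cbilinearI:
  assumes "\<And>a a' b. f (a + a') b = f a b + f a' b" "\<And>a b b'. f a (b + b') = f a b + f a b'"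
    "\<And>c a b. f (c *\<^sub>C a) b = c *\<^sub>C f a b" "\<And>c a b. f a (c *\<^sub>C b) = c *\<^sub>C f a b"
  shows "cbilinear f"
  unfolding cbilinear_def using assms by (auto intro!: clinearI)

lemma
  assumes "cbilinear f"
  shows cbilinear_add_left: "f (a + a') b = f a b + f a' b"
    and cbilinear_add_right: "f a (b + b') = f a b + f a b'"
    and cbilinear_scaleC_left: "f (c *\<^sub>C a) b = c *\<^sub>C f a b"
    and cbilinear_scaleC_right: "f a (c *\<^sub>C b) = c *\<^sub>C f a b"
    and cbilinear_0_left: "f 0 b = 0"
    and cbilinear_0_right: "f a 0 = 0"
proof -
  have l: "clinear (\<lambda>a. f a b)" and r: "clinear (f a)" for a b
    using assms by (auto simp: cbilinear_def)
  show "f (a + a') b = f a b + f a' b" "f (c *\<^sub>C a) b = c *\<^sub>C f a b" "f 0 b = 0"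
    using clinear_add[OF l] clinear_scaleC[OF l] clinear_0[OF l] by auto
  show "f a (b + b') = f a b + f a b'" "f a (c *\<^sub>C b) = c *\<^sub>C f a b" "f a 0 = 0"
    using clinear_add[OF r] clinear_scaleC[OF r] clinear_0[OF r] by auto
qed

lemma exists_functional:
  fixes x :: "'a::complex_vector"
  assumes "x \<noteq> 0"
  shows "\<exists>f :: 'a \<Rightarrow> complex. Vector_Spaces.linear scaleC (*) f \<and> f x = 1"
proof -
  interpret c: vector_space "(*) :: complex \<Rightarrow> complex \<Rightarrow> complex"
    by unfold_locales (auto simp: algebra_simps)
  interpret p: vector_space_pair "scaleC :: complex \<Rightarrow> 'a \<Rightarrow> 'a" "(*) :: complex \<Rightarrow> complex \<Rightarrow> complex"
    by unfold_locales
  have "complex_vector.independent {x}"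
    using assms by (simp add: complex_vector.dependent_single)
  then show ?thesis
    using p.linear_independent_extend[of "{x}" "\<lambda>_. 1"] by auto
qed

instantiation complex :: complex_algebra_1
begin

definition scaleC_complex :: "complex \<Rightarrow> complex \<Rightarrow> complex"
  where "scaleC_complex = (*)"

instance
  by standard (auto simp: scaleC_complex_def algebra_simps)

end

section \<open>Free vector spaces\<close>

instantiation poly_mapping :: (type, complex_vector) complex_vector
begin

lift_definition scaleC_poly_mapping :: "complex \<Rightarrow> ('a \<Rightarrow>\<^sub>0 'b) \<Rightarrow> ('a \<Rightarrow>\<^sub>0 'b)"
  is "\<lambda>c f x. c *\<^sub>C f x"
  by (erule finite_subset[rotated]) auto

instance
  by standard (transfer; simp add: fun_eq_iff scaleC_add_right scaleC_add_left scaleC_scaleC scaleC_one)+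

end

lemma lookup_scaleC: "Poly_Mapping.lookup (c *\<^sub>C p) x = c *\<^sub>C Poly_Mapping.lookup p x"
  by transfer simp

lemma scaleC_single: "c *\<^sub>C Poly_Mapping.single x a = Poly_Mapping.single x (c *\<^sub>C a)"
  by (rule poly_mapping_eqI) (auto simp: lookup_scaleC lookup_single when_def)

lemma poly_mapping_sum_single:
  fixes p :: "'a \<Rightarrow>\<^sub>0 'b::comm_monoid_add"
  shows "p = (\<Sum>x\<in>Poly_Mapping.keys p. Poly_Mapping.single x (Poly_Mapping.lookup p x))"
  by (rule poly_mapping_eqI)
    (auto simp: lookup_sum lookup_single when_def in_keys_iff sum.delta)

lemma poly_mapping_single_induct [case_names zero add]:
  fixes p :: "'a \<Rightarrow>\<^sub>0 'b::comm_monoid_add"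
  assumes "P 0" "\<And>x c p. P p \<Longrightarrow> P (Poly_Mapping.single x c + p)"
  shows "P p"
proof -
  have "P (\<Sum>x\<in>A. Poly_Mapping.single x (Poly_Mapping.lookup p x))" if "finite A" for A
    using that by induction (auto intro: assms)
  from this[of "Poly_Mapping.keys p"] show ?thesis
    using poly_mapping_sum_single[of p] by simp
qed

instance poly_mapping :: (monoid_add, complex_algebra_1) complex_algebra_1
proof
  fix c and p q :: "'a \<Rightarrow>\<^sub>0 'b"
  have s: "(c *\<^sub>C Poly_Mapping.single x a) * q = c *\<^sub>C (Poly_Mapping.single x a * q)" for x a
    by (induction q rule: poly_mapping_single_induct)
      (auto simp: distrib_left scaleC_add_right scaleC_single mult_single mult_scaleC_left)
  show "(c *\<^sub>C p) * q = c *\<^sub>C (p * q)"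
    by (induction p rule: poly_mapping_single_induct)
      (auto simp: distrib_right scaleC_add_right s)
  have s: "Poly_Mapping.single x a * (c *\<^sub>C q) = c *\<^sub>C (Poly_Mapping.single x a * q)" for x a
    by (induction q rule: poly_mapping_single_induct)
      (auto simp: distrib_left scaleC_add_right scaleC_single mult_single mult_scaleC_right)
  show "p * (c *\<^sub>C q) = c *\<^sub>C (p * q)"
    by (induction p rule: poly_mapping_single_induct)
      (auto simp: distrib_right scaleC_add_right s)
qed

definition free_lift :: "('x \<Rightarrow> 'v::complex_vector) \<Rightarrow> ('x \<Rightarrow>\<^sub>0 complex) \<Rightarrow> 'v"
  where "free_lift g p = (\<Sum>x\<in>Poly_Mapping.keys p. Poly_Mapping.lookup p x *\<^sub>C g x)"

lemma free_lift_superset: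
  "finite A \<Longrightarrow> Poly_Mapping.keys p \<subseteq> A \<Longrightarrow> free_lift g p = (\<Sum>x\<in>A. Poly_Mapping.lookup p x *\<^sub>C g x)"
  unfolding free_lift_def by (rule sum.mono_neutral_left) (auto simp: in_keys_iff)

lemma clinear_free_lift: "clinear (free_lift g)"
proof (rule clinearI)
  fix p q
  have "free_lift g (p + q) = (\<Sum>x\<in>Poly_Mapping.keys p \<union> Poly_Mapping.keys q. Poly_Mapping.lookup (p + q) x *\<^sub>C g x)"
    by (rule free_lift_superset) (auto dest: subsetD[OF Poly_Mapping.keys_add])
  also have "\<dots> = free_lift g p + free_lift g q"
    by (simp add: lookup_add scaleC_add_left sum.distrib free_lift_superset[of "Poly_Mapping.keys p \<union> Poly_Mapping.keys q"])
  finally show "free_lift g (p + q) = free_lift g p + free_lift g q" .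
next
  fix c p
  have "free_lift g (c *\<^sub>C p) = (\<Sum>x\<in>Poly_Mapping.keys p. Poly_Mapping.lookup (c *\<^sub>C p) x *\<^sub>C g x)"
    by (rule free_lift_superset) (auto simp: in_keys_iff lookup_scaleC)
  then show "free_lift g (c *\<^sub>C p) = c *\<^sub>C free_lift g p"
    by (simp add: lookup_scaleC scaleC_complex_def free_lift_def
        complex_vector.scale_sum_right scaleC_scaleC)
qed

lemma free_lift_single: "free_lift g (Poly_Mapping.single x c) = c *\<^sub>C g x"
  by (cases "c = 0") (auto simp: free_lift_def)

section \<open>Tensor products\<close>

text \<open>The algebraic tensor product over \<open>\<complex>\<close>: the free vector space on pairs
  modulo the subspace spanned by the bilinearity relations.\<close>

definition tensor_relations :: "('a::complex_vector \<times> 'b::complex_vector \<Rightarrow>\<^sub>0 complex) set"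
  where "tensor_relations =
    {Poly_Mapping.single (a + a', b) 1 - Poly_Mapping.single (a, b) 1 - Poly_Mapping.single (a', b) 1 | a a' b. True} \<union>
    {Poly_Mapping.single (a, b + b') 1 - Poly_Mapping.single (a, b) 1 - Poly_Mapping.single (a, b') 1 | a b b'. True} \<union>
    {Poly_Mapping.single (c *\<^sub>C a, b) 1 - Poly_Mapping.single (a, b) c | c a b. True} \<union>
    {Poly_Mapping.single (a, c *\<^sub>C b) 1 - Poly_Mapping.single (a, b) c | c a b. True}"

definition tensor_eq :: "('a::complex_vector \<times> 'b::complex_vector \<Rightarrow>\<^sub>0 complex) \<Rightarrow> ('a \<times> 'b \<Rightarrow>\<^sub>0 complex) \<Rightarrow> bool"
  where "tensor_eq p q \<longleftrightarrow> p - q \<in> complex_vector.span tensor_relations"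

quotient_type (overloaded) ('a, 'b) tensor (infixr \<open>\<otimes>\<close> 74) =
  "('a::complex_vector \<times> 'b::complex_vector) \<Rightarrow>\<^sub>0 complex" / tensor_eq
proof (rule equivpI)
  show "reflp (tensor_eq :: ('a \<times> 'b \<Rightarrow>\<^sub>0 complex) \<Rightarrow> _)"
    by (rule reflpI) (simp add: tensor_eq_def complex_vector.span_zero)
  show "symp (tensor_eq :: ('a \<times> 'b \<Rightarrow>\<^sub>0 complex) \<Rightarrow> _)"
  proof (rule sympI)
    fix p q :: "'a \<times> 'b \<Rightarrow>\<^sub>0 complex"
    assume "tensor_eq p q"
    then have "- (p - q) \<in> complex_vector.span tensor_relations"
      unfolding tensor_eq_def by (rule complex_vector.span_neg)
    then show "tensor_eq q p"
      unfolding tensor_eq_def by simp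
  qed
  show "transp (tensor_eq :: ('a \<times> 'b \<Rightarrow>\<^sub>0 complex) \<Rightarrow> _)"
  proof (rule transpI)
    fix p q r :: "'a \<times> 'b \<Rightarrow>\<^sub>0 complex"
    assume "tensor_eq p q" "tensor_eq q r"
    then have "(p - q) + (q - r) \<in> complex_vector.span tensor_relations"
      unfolding tensor_eq_def by (rule complex_vector.span_add)
    then show "tensor_eq p r"
      unfolding tensor_eq_def by simp
  qed
qed

instantiation tensor :: (complex_vector, complex_vector) complex_vector
begin

lift_definition zero_tensor :: "'a \<otimes> 'b" is 0 .

lift_definition plus_tensor :: "'a \<otimes> 'b \<Rightarrow> 'a \<otimes> 'b \<Rightarrow> 'a \<otimes> 'b" is "(+)"
proof -
  fix p p' q q' :: "'a \<times> 'b \<Rightarrow>\<^sub>0 complex"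
  assume "tensor_eq p p'" "tensor_eq q q'"
  then have "(p - p') + (q - q') \<in> complex_vector.span tensor_relations"
    unfolding tensor_eq_def by (rule complex_vector.span_add)
  then show "tensor_eq (p + q) (p' + q')"
    unfolding tensor_eq_def by (simp add: algebra_simps)
qed

lift_definition uminus_tensor :: "'a \<otimes> 'b \<Rightarrow> 'a \<otimes> 'b" is uminus
proof -
  fix p p' :: "'a \<times> 'b \<Rightarrow>\<^sub>0 complex"
  assume "tensor_eq p p'"
  then have "- (p - p') \<in> complex_vector.span tensor_relations"
    unfolding tensor_eq_def by (rule complex_vector.span_neg)
  then show "tensor_eq (- p) (- p')"
    unfolding tensor_eq_def by simp
qed

lift_definition minus_tensor :: "'a \<otimes> 'b \<Rightarrow> 'a \<otimes> 'b \<Rightarrow> 'a \<otimes> 'b" is "(-)"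
proof -
  fix p p' q q' :: "'a \<times> 'b \<Rightarrow>\<^sub>0 complex"
  assume "tensor_eq p p'" "tensor_eq q q'"
  then have "(p - p') - (q - q') \<in> complex_vector.span tensor_relations"
    unfolding tensor_eq_def by (rule complex_vector.span_diff)
  then show "tensor_eq (p - q) (p' - q')"
    unfolding tensor_eq_def by (simp add: algebra_simps)
qed

lift_definition scaleC_tensor :: "complex \<Rightarrow> 'a \<otimes> 'b \<Rightarrow> 'a \<otimes> 'b" is scaleC
proof -
  fix c and p p' :: "'a \<times> 'b \<Rightarrow>\<^sub>0 complex"
  assume "tensor_eq p p'"
  then have "c *\<^sub>C (p - p') \<in> complex_vector.span tensor_relations"
    unfolding tensor_eq_def by (rule complex_vector.span_scale)
  then show "tensor_eq (c *\<^sub>C p) (c *\<^sub>C p')"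
    unfolding tensor_eq_def by (simp add: complex_vector.scale_right_diff_distrib)
qed

instance
proof
  fix x y z :: "'a \<otimes> 'b" and c d :: complex
  have refl: "p = q \<Longrightarrow> tensor_eq p q" for p q :: "'a \<times> 'b \<Rightarrow>\<^sub>0 complex"
    by (simp add: tensor_eq_def complex_vector.span_zero)
  show "x + y + z = x + (y + z)" by transfer (rule refl, simp add: algebra_simps)
  show "x + y = y + x" by transfer (rule refl, simp add: algebra_simps)
  show "0 + x = x" by transfer (rule refl, simp)
  show "- x + x = 0" by transfer (rule refl, simp)
  show "x - y = x + - y" by transfer (rule refl, simp)
  show "c *\<^sub>C (x + y) = c *\<^sub>C x + c *\<^sub>C y" by transfer (rule refl, simp add: scaleC_add_right)
  show "(c + d) *\<^sub>C x = c *\<^sub>C x + d *\<^sub>C x" by transfer (rule refl, simp add: scaleC_add_left)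
  show "c *\<^sub>C (d *\<^sub>C x) = (c * d) *\<^sub>C x" by transfer (rule refl, simp add: scaleC_scaleC)
  show "1 *\<^sub>C x = x" by transfer (rule refl, simp add: scaleC_one)
qed

end

lift_definition tensor :: "'a::complex_vector \<Rightarrow> 'b::complex_vector \<Rightarrow> 'a \<otimes> 'b" (infixr \<open>\<otimes>\<close> 74)
  is "\<lambda>a b. Poly_Mapping.single (a, b) 1" .

lemma cbilinear_tensor: "cbilinear ((\<otimes>) :: 'a::complex_vector \<Rightarrow> 'b::complex_vector \<Rightarrow> _)"
proof (rule cbilinearI)
  fix a a' :: 'a and b b' :: 'b and c
  show "(a + a') \<otimes> b = a \<otimes> b + a' \<otimes> b"
    by transfer (simp only: tensor_eq_def diff_diff_eq[symmetric],
        rule complex_vector.span_base, unfold tensor_relations_def, blast)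
  show "a \<otimes> (b + b') = a \<otimes> b + a \<otimes> b'"
    by transfer (simp only: tensor_eq_def diff_diff_eq[symmetric],
        rule complex_vector.span_base, unfold tensor_relations_def, blast)
  have s: "c *\<^sub>C Poly_Mapping.single (a, b) 1 = Poly_Mapping.single (a, b) c"
    by (simp add: scaleC_single scaleC_complex_def)
  show "(c *\<^sub>C a) \<otimes> b = c *\<^sub>C (a \<otimes> b)"
    by transfer (simp only: tensor_eq_def scaleC_single scaleC_complex_def mult_1_right,
        rule complex_vector.span_base, unfold tensor_relations_def, blast)
  show "a \<otimes> (c *\<^sub>C b) = c *\<^sub>C (a \<otimes> b)"
    by transfer (simp only: tensor_eq_def scaleC_single scaleC_complex_def mult_1_right,
        rule complex_vector.span_base, unfold tensor_relations_def, blast)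
qed

lemmas tensor_add_left = cbilinear_add_left[OF cbilinear_tensor]
  and tensor_add_right = cbilinear_add_right[OF cbilinear_tensor]
  and tensor_scaleC_left = cbilinear_scaleC_left[OF cbilinear_tensor]
  and tensor_scaleC_right = cbilinear_scaleC_right[OF cbilinear_tensor]
  and tensor_0_left = cbilinear_0_left[OF cbilinear_tensor]
  and tensor_0_right = cbilinear_0_right[OF cbilinear_tensor]

lemma tensor_induct [case_names zero tensor add]:
  assumes "P 0" "\<And>a b. P (a \<otimes> b)" "\<And>s t. P s \<Longrightarrow> P t \<Longrightarrow> P (s + t)"
  shows "P (t :: 'a::complex_vector \<otimes> 'b::complex_vector)"
proof -
  have "P (abs_tensor p)" for p :: "'a \<times> 'b \<Rightarrow>\<^sub>0 complex"
  proof (induction p rule: poly_mapping_single_induct)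
    case zero
    then show ?case using assms(1) by (simp add: zero_tensor_def)
  next
    case (add x c p)
    obtain a b where x: "x = (a, b)" by (cases x)
    have "abs_tensor (Poly_Mapping.single x c + p) = c *\<^sub>C (a \<otimes> b) + abs_tensor p"
      by (simp add: plus_tensor.abs_eq tensor.abs_eq scaleC_tensor.abs_eq x scaleC_single
          scaleC_complex_def)
    also have "\<dots> = (c *\<^sub>C a) \<otimes> b + abs_tensor p" by (simp add: tensor_scaleC_left)
    finally show ?case using assms add by simp
  qed
  from this[of "rep_tensor t"] show ?thesis
    using Quotient_abs_rep[OF Quotient_tensor] by metis
qed

text \<open>The linear map induced by a bilinear one; meaningful only for bilinear arguments.\<close>

definition tensor_lift ::
    "('a::complex_vector \<Rightarrow> 'b::complex_vector \<Rightarrow> 'c::complex_vector) \<Rightarrow> 'a \<otimes> 'b \<Rightarrow> 'c"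
  where "tensor_lift f t = free_lift (\<lambda>(a, b). f a b) (rep_tensor t)"

lemma tensor_lift_abs:
  assumes "cbilinear f"
  shows "tensor_lift f (abs_tensor p) = free_lift (\<lambda>(a, b). f a b) p"
proof -
  let ?F = "free_lift (\<lambda>(a, b). f a b)"
  have base: "?F r = 0" if "r \<in> tensor_relations" for r
    using that unfolding tensor_relations_def
    by (auto simp: clinear_diff[OF clinear_free_lift] free_lift_single scaleC_one
        cbilinear_add_left[OF assms] cbilinear_add_right[OF assms]
        cbilinear_scaleC_left[OF assms] cbilinear_scaleC_right[OF assms])
  have null: "?F r = 0" if "r \<in> complex_vector.span tensor_relations" for r
    using that by (induction rule: complex_vector.span_induct_alt)
      (auto simp: base clinear_0[OF clinear_free_lift] clinear_add[OF clinear_free_lift]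
        clinear_scaleC[OF clinear_free_lift])
  have "tensor_eq (rep_tensor (abs_tensor p)) p"
    by (rule Quotient_rep_abs[OF Quotient_tensor]) (simp add: tensor_eq_def complex_vector.span_zero)
  then show ?thesis
    using null[of "rep_tensor (abs_tensor p) - p"]
    by (simp add: tensor_eq_def tensor_lift_def clinear_diff[OF clinear_free_lift])
qed

lemma tensor_lift_tensor: "cbilinear f \<Longrightarrow> tensor_lift f (a \<otimes> b) = f a b"
  by (simp add: tensor.abs_eq tensor_lift_abs free_lift_single scaleC_one)

lemma clinear_tensor_lift:
  assumes "cbilinear f"
  shows "clinear (tensor_lift f)"
proof (rule clinearI)
  fix s t :: "'a \<otimes> 'b" and c
  obtain p q where pq: "s = abs_tensor p" "t = abs_tensor q"
    by (metis Quotient_abs_rep[OF Quotient_tensor])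
  show "tensor_lift f (s + t) = tensor_lift f s + tensor_lift f t"
    by (simp add: pq plus_tensor.abs_eq tensor_lift_abs[OF assms] clinear_add[OF clinear_free_lift])
  show "tensor_lift f (c *\<^sub>C s) = c *\<^sub>C tensor_lift f s"
    by (simp add: pq scaleC_tensor.abs_eq tensor_lift_abs[OF assms] clinear_scaleC[OF clinear_free_lift])
qed

lemma tensor_lift_unique:
  assumes "clinear F" "clinear G" "\<And>a b. F (a \<otimes> b) = G (a \<otimes> b)"
  shows "F t = G t"
  by (induction t rule: tensor_induct)
    (simp_all add: assms clinear_0[OF assms(1)] clinear_0[OF assms(2)]
      clinear_add[OF assms(1)] clinear_add[OF assms(2)])

lemma tensor_lift_add_fun: "tensor_lift (\<lambda>a b. f a b + g a b) t = tensor_lift f t + tensor_lift g t"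
  by (simp add: tensor_lift_def free_lift_def case_prod_unfold scaleC_add_right sum.distrib)

lemma tensor_lift_scaleC_fun: "tensor_lift (\<lambda>a b. c *\<^sub>C f a b) t = c *\<^sub>C tensor_lift f t"
  by (simp add: tensor_lift_def free_lift_def case_prod_unfold scaleC_scaleC
      complex_vector.scale_sum_right mult.commute)

definition tensor_flip :: "'a::complex_vector \<otimes> 'b::complex_vector \<Rightarrow> 'b \<otimes> 'a"
  where "tensor_flip = tensor_lift (\<lambda>a b. b \<otimes> a)"

definition tensor_assoc ::
    "('a::complex_vector \<otimes> 'b::complex_vector) \<otimes> 'c::complex_vector \<Rightarrow> 'a \<otimes> 'b \<otimes> 'c"
  where "tensor_assoc = tensor_lift (\<lambda>s c. tensor_lift (\<lambda>a b. a \<otimes> b \<otimes> c) s)"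

definition tensor_left_unit :: "complex \<otimes> 'a::complex_vector \<Rightarrow> 'a"
  where "tensor_left_unit = tensor_lift (\<lambda>c a. c *\<^sub>C a)"

definition tensor_right_unit :: "'a::complex_vector \<otimes> complex \<Rightarrow> 'a"
  where "tensor_right_unit = tensor_lift (\<lambda>a c. c *\<^sub>C a)"

lemma tensor_flip_tensor: "tensor_flip (a \<otimes> b) = b \<otimes> a"
  unfolding tensor_flip_def
  by (rule tensor_lift_tensor)
    (simp add: cbilinearI tensor_add_left tensor_add_right tensor_scaleC_left tensor_scaleC_right)

lemma tensor_assoc_tensor: "tensor_assoc ((a \<otimes> b) \<otimes> c) = a \<otimes> b \<otimes> c"
proof -
  have b: "cbilinear (\<lambda>a b. a \<otimes> b \<otimes> c)" for c :: 'c
    by (simp add: cbilinearI tensor_add_left tensor_add_right tensor_scaleC_left tensor_scaleC_right)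
  have "cbilinear (\<lambda>s c. tensor_lift (\<lambda>a b. (a::'a) \<otimes> (b::'b) \<otimes> (c::'c)) s)"
    by (rule cbilinearI)
      (simp_all add: clinear_add[OF clinear_tensor_lift[OF b]] clinear_scaleC[OF clinear_tensor_lift[OF b]]
        tensor_add_right tensor_scaleC_right tensor_lift_add_fun tensor_lift_scaleC_fun)
  then show ?thesis
    by (simp add: tensor_assoc_def tensor_lift_tensor b)
qed

lemma tensor_left_unit_tensor: "tensor_left_unit (c \<otimes> a) = c *\<^sub>C a"
  unfolding tensor_left_unit_def
  by (rule tensor_lift_tensor)
    (simp add: cbilinearI scaleC_add_left scaleC_add_right scaleC_complex_def scaleC_scaleC mult.commute)

lemma tensor_right_unit_tensor: "tensor_right_unit (a \<otimes> c) = c *\<^sub>C a"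
  unfolding tensor_right_unit_def
  by (rule tensor_lift_tensor)
    (simp add: cbilinearI scaleC_add_left scaleC_add_right scaleC_complex_def scaleC_scaleC mult.commute)

lemma cbilinear_tensor_mult_right:
  fixes a :: "'a::complex_algebra_1" and b :: "'b::complex_algebra_1"
  shows "cbilinear (\<lambda>a' b'. (a * a') \<otimes> (b * b'))"
  by (rule cbilinearI) (simp_all add: distrib_left mult_scaleC_right
      tensor_add_left tensor_add_right tensor_scaleC_left tensor_scaleC_right)

lemma cbilinear_tensor_mult_left:
  fixes t :: "'a::complex_algebra_1 \<otimes> 'b::complex_algebra_1"
  shows "cbilinear (\<lambda>a b. tensor_lift (\<lambda>a' b'. (a * a') \<otimes> (b * b')) t)"
  by (rule cbilinearI) (simp_all add: distrib_right mult_scaleC_left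
      tensor_add_left tensor_add_right tensor_scaleC_left tensor_scaleC_right
      tensor_lift_add_fun tensor_lift_scaleC_fun)

instantiation tensor :: (complex_algebra_1, complex_algebra_1) complex_algebra_1
begin

definition one_tensor :: "'a \<otimes> 'b"
  where "one_tensor = 1 \<otimes> 1"

definition times_tensor :: "'a \<otimes> 'b \<Rightarrow> 'a \<otimes> 'b \<Rightarrow> 'a \<otimes> 'b"
  where "times_tensor s t = tensor_lift (\<lambda>a b. tensor_lift (\<lambda>a' b'. (a * a') \<otimes> (b * b')) t) s"

instance
proof
  note b1 = cbilinear_tensor_mult_right and b2 = cbilinear_tensor_mult_left
  have mult: "(a \<otimes> b) * (a' \<otimes> b') = (a * a') \<otimes> (b * b')" for a a' :: 'a and b b' :: 'b
    by (subst times_tensor_def, subst tensor_lift_tensor[OF cbilinear_tensor_mult_left],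
      rule tensor_lift_tensor[OF cbilinear_tensor_mult_right])
  fix s t u :: "'a \<otimes> 'b" and c :: complex
  show dr: "(s + t) * u = s * u + t * u" for s t u :: "'a \<otimes> 'b"
    by (simp add: times_tensor_def clinear_add[OF clinear_tensor_lift[OF b2]])
  have z: "0 * u = 0" for u :: "'a \<otimes> 'b"
    by (simp add: times_tensor_def clinear_0[OF clinear_tensor_lift[OF b2]])
  show sl: "(c *\<^sub>C s) * t = c *\<^sub>C (s * t)" for s t :: "'a \<otimes> 'b"
    by (simp add: times_tensor_def clinear_scaleC[OF clinear_tensor_lift[OF b2]])
  have pure: "(a \<otimes> b) * t = tensor_lift (\<lambda>a' b'. (a * a') \<otimes> (b * b')) t"
    for a :: 'a and b :: 'b and t
    by (simp add: times_tensor_def tensor_lift_tensor[OF b2])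
  show dl: "u * (s + t) = u * s + u * t" for s t u :: "'a \<otimes> 'b"
    by (induction u rule: tensor_induct)
      (simp_all add: z dr pure clinear_add[OF clinear_tensor_lift[OF b1]] add.assoc add.left_commute)
  have zr: "u * 0 = 0" for u :: "'a \<otimes> 'b"
    by (induction u rule: tensor_induct)
      (simp_all add: z dr pure clinear_0[OF clinear_tensor_lift[OF b1]])
  show "s * (c *\<^sub>C t) = c *\<^sub>C (s * t)"
    by (induction s rule: tensor_induct)
      (simp_all add: z dr pure clinear_scaleC[OF clinear_tensor_lift[OF b1]] scaleC_add_right)
  have "(a \<otimes> b) * (a' \<otimes> b') * u = (a \<otimes> b) * ((a' \<otimes> b') * u)" for a a' :: 'a and b b' :: 'b
    by (induction u rule: tensor_induct) (simp_all add: zr dl mult mult.assoc)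
  then have "(a \<otimes> b) * t * u = (a \<otimes> b) * (t * u)" for a :: 'a and b :: 'b
    by (induction t rule: tensor_induct) (simp_all add: z zr dr dl)
  then show "s * t * u = s * (t * u)"
    by (induction s rule: tensor_induct) (simp_all add: z dr)
  show "1 * s = s"
    by (induction s rule: tensor_induct) (simp_all add: zr dl mult one_tensor_def)
  show "s * 1 = s"
    by (induction s rule: tensor_induct) (simp_all add: z dr mult one_tensor_def)
  show "(0::'a \<otimes> 'b) \<noteq> 1"
  proof
    assume *: "(0::'a \<otimes> 'b) = 1"
    obtain f :: "'a \<Rightarrow> complex" where f: "clinear f" "f 1 = 1"
      using exists_functional[of "1::'a"] by (auto simp: scaleC_complex_def)
    obtain g :: "'b \<Rightarrow> complex" where g: "clinear g" "g 1 = 1"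
      using exists_functional[of "1::'b"] by (auto simp: scaleC_complex_def)
    have fg: "cbilinear (\<lambda>a b. f a * g b)"
      by (rule cbilinearI) (simp_all add: clinear_add[OF f(1)] clinear_add[OF g(1)]
          clinear_scaleC[OF f(1)] clinear_scaleC[OF g(1)] algebra_simps scaleC_complex_def)
    have "tensor_lift (\<lambda>a b. f a * g b) (1 \<otimes> 1) = 1"
      by (simp add: tensor_lift_tensor[OF fg] f g)
    moreover have "(1::'a) \<otimes> (1::'b) = 0"
      using * by (simp add: one_tensor_def)
    ultimately show False
      by (simp add: clinear_0[OF clinear_tensor_lift[OF fg]])
  qed
qed

end

lemma tensor_mult_tensor:
  fixes a a' :: "'a::complex_algebra_1" and b b' :: "'b::complex_algebra_1"
  shows "(a \<otimes> b) * (a' \<otimes> b') = (a * a') \<otimes> (b * b')"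
  by (subst times_tensor_def, subst tensor_lift_tensor[OF cbilinear_tensor_mult_left],
      rule tensor_lift_tensor[OF cbilinear_tensor_mult_right])

section \<open>Lie algebras\<close>

class complex_lie_algebra = complex_vector +
  fixes lie :: "'a \<Rightarrow> 'a \<Rightarrow> 'a"
  assumes lie_add_left: "lie (x + y) z = lie x z + lie y z"
    and lie_add_right: "lie x (y + z) = lie x y + lie x z"
    and lie_scaleC_left: "lie (c *\<^sub>C x) y = c *\<^sub>C lie x y"
    and lie_scaleC_right: "lie x (c *\<^sub>C y) = c *\<^sub>C lie x y"
    and lie_self: "lie x x = 0"
    and jacobi: "lie x (lie y z) + lie y (lie z x) + lie z (lie x y) = 0"

definition lie_ideal :: "'g::complex_lie_algebra set \<Rightarrow> bool"
  where "lie_ideal I \<longleftrightarrow> complex_vector.subspace I \<and> (\<forall>x. \<forall>y\<in>I. lie x y \<in> I)"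

fun derived_series :: "'g::complex_lie_algebra set \<Rightarrow> nat \<Rightarrow> 'g set" where
  "derived_series I 0 = I"
| "derived_series I (Suc n) =
    complex_vector.span {lie x y | x y. x \<in> derived_series I n \<and> y \<in> derived_series I n}"

definition lie_solvable :: "'g::complex_lie_algebra set \<Rightarrow> bool"
  where "lie_solvable I \<longleftrightarrow> (\<exists>n. derived_series I n = {0})"

text \<open>Vanishing of the radical, that is, of all solvable ideals.\<close>

definition semisimple :: "'g::complex_lie_algebra itself \<Rightarrow> bool"
  where "semisimple _ \<longleftrightarrow> (\<forall>I::'g set. lie_ideal I \<and> lie_solvable I \<longrightarrow> I = {0})"

section \<open>The universal enveloping algebra\<close>

datatype 'a word = Word (letters: "'a list")

instantiation word :: (type) monoid_add
begin

definition zero_word :: "'a word"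
  where "zero_word = Word []"

definition plus_word :: "'a word \<Rightarrow> 'a word \<Rightarrow> 'a word"
  where "plus_word v w = Word (letters v @ letters w)"

instance
  by standard (auto simp: zero_word_def plus_word_def)

end

text \<open>With concatenation as the addition of words, the convolution product of
  \<^theory>\<open>HOL-Library.Poly_Mapping\<close> makes \<^typ>\<open>'a word \<Rightarrow>\<^sub>0 complex\<close> the free
  unital associative algebra on the set \<^typ>\<open>'a\<close>.\<close>

definition letter :: "'a \<Rightarrow> 'a word \<Rightarrow>\<^sub>0 complex"
  where "letter x = Poly_Mapping.single (Word [x]) 1"

inductive_set two_sided_ideal :: "'a::ring_1 set \<Rightarrow> 'a set" for S where
  zero: "0 \<in> two_sided_ideal S"
| base: "a \<in> S \<Longrightarrow> a \<in> two_sided_ideal S"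
| add: "a \<in> two_sided_ideal S \<Longrightarrow> b \<in> two_sided_ideal S \<Longrightarrow> a + b \<in> two_sided_ideal S"
| mult_left: "a \<in> two_sided_ideal S \<Longrightarrow> b * a \<in> two_sided_ideal S"
| mult_right: "a \<in> two_sided_ideal S \<Longrightarrow> a * b \<in> two_sided_ideal S"

text \<open>The first two families cut the free algebra on the underlying set of the Lie algebra
  down to its tensor algebra.\<close>

definition uea_relations :: "('g::complex_lie_algebra word \<Rightarrow>\<^sub>0 complex) set"
  where "uea_relations =
    {letter (x + y) - letter x - letter y | x y. True} \<union>
    {letter (c *\<^sub>C x) - c *\<^sub>C letter x | c x. True} \<union>
    {letter x * letter y - letter y * letter x - letter (lie x y) | x y. True}"

definition uea_eq :: "('g::complex_lie_algebra word \<Rightarrow>\<^sub>0 complex) \<Rightarrow> ('g word \<Rightarrow>\<^sub>0 complex) \<Rightarrow> bool"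
  where "uea_eq p q \<longleftrightarrow> p - q \<in> two_sided_ideal uea_relations"

lemma two_sided_ideal_uminus: "a \<in> two_sided_ideal S \<Longrightarrow> - a \<in> two_sided_ideal S"
  using two_sided_ideal.mult_left[of a S "-1"] by simp

lemma two_sided_ideal_diff:
  "a \<in> two_sided_ideal S \<Longrightarrow> b \<in> two_sided_ideal S \<Longrightarrow> a - b \<in> two_sided_ideal S"
  using two_sided_ideal.add[of a S "- b"] two_sided_ideal_uminus by auto

lemma two_sided_ideal_scaleC:
  fixes a :: "'a::complex_algebra_1"
  shows "a \<in> two_sided_ideal S \<Longrightarrow> c *\<^sub>C a \<in> two_sided_ideal S"
  using two_sided_ideal.mult_left[of a S "c *\<^sub>C 1"] by (simp add: mult_scaleC_left)

quotient_type (overloaded) 'g uea = "'g::complex_lie_algebra word \<Rightarrow>\<^sub>0 complex" / uea_eq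
proof (rule equivpI)
  show "reflp (uea_eq :: ('g word \<Rightarrow>\<^sub>0 complex) \<Rightarrow> _)"
    by (rule reflpI) (simp add: uea_eq_def two_sided_ideal.zero)
  show "symp (uea_eq :: ('g word \<Rightarrow>\<^sub>0 complex) \<Rightarrow> _)"
  proof (rule sympI)
    fix p q :: "'g word \<Rightarrow>\<^sub>0 complex"
    assume "uea_eq p q"
    then have "- (p - q) \<in> two_sided_ideal uea_relations"
      unfolding uea_eq_def by (rule two_sided_ideal_uminus)
    then show "uea_eq q p"
      unfolding uea_eq_def by simp
  qed
  show "transp (uea_eq :: ('g word \<Rightarrow>\<^sub>0 complex) \<Rightarrow> _)"
  proof (rule transpI)
    fix p q r :: "'g word \<Rightarrow>\<^sub>0 complex"
    assume "uea_eq p q" "uea_eq q r"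
    then have "(p - q) + (q - r) \<in> two_sided_ideal uea_relations"
      unfolding uea_eq_def by (rule two_sided_ideal.add)
    then show "uea_eq p r"
      unfolding uea_eq_def by simp
  qed
qed

definition falg_lift :: "('x \<Rightarrow> 'a::complex_algebra_1) \<Rightarrow> ('x word \<Rightarrow>\<^sub>0 complex) \<Rightarrow> 'a"
  where "falg_lift f = free_lift (\<lambda>w. prod_list (map f (letters w)))"

lemma clinear_falg_lift: "clinear (falg_lift f)"
  by (simp add: falg_lift_def clinear_free_lift)

lemma falg_lift_letter: "falg_lift f (letter x) = f x"
  by (simp add: falg_lift_def letter_def free_lift_single scaleC_one)

lemma falg_lift_one: "falg_lift f 1 = 1"
  by (simp add: falg_lift_def single_one[symmetric] free_lift_single zero_word_def scaleC_one
      del: single_one)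

lemma falg_lift_mult: "falg_lift f (p * q) = falg_lift f p * falg_lift f q"
proof -
  note [simp] = clinear_add[OF clinear_falg_lift] clinear_0[OF clinear_falg_lift]
  have "falg_lift f (Poly_Mapping.single v c * q) = falg_lift f (Poly_Mapping.single v c) * falg_lift f q"
    for v c
  proof (induction q rule: poly_mapping_single_induct)
    case (add w d q)
    have "falg_lift f (Poly_Mapping.single v c * Poly_Mapping.single w d) =
        falg_lift f (Poly_Mapping.single v c) * falg_lift f (Poly_Mapping.single w d)"
      by (simp add: mult_single falg_lift_def free_lift_single plus_word_def
          mult_scaleC_left mult_scaleC_right scaleC_scaleC)
    with add show ?case by (simp add: distrib_left)
  qed auto
  then show ?thesis
    by (induction p rule: poly_mapping_single_induct) (simp_all add: distrib_right)
qed

lemma falg_lift_ideal: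
  assumes f: "clinear f" "\<And>x y. f (lie x y) = f x * f y - f y * f x"
    and "p \<in> two_sided_ideal uea_relations"
  shows "falg_lift f p = 0"
  using assms(3)
proof induction
  case (base p)
  then show ?case
    by (auto simp: uea_relations_def clinear_diff[OF clinear_falg_lift] falg_lift_letter
        clinear_add[OF f(1)] clinear_scaleC[OF f(1)] clinear_scaleC[OF clinear_falg_lift]
        falg_lift_mult f(2))
qed (simp_all add: clinear_0[OF clinear_falg_lift] clinear_add[OF clinear_falg_lift] falg_lift_mult)

instantiation uea :: (complex_lie_algebra) complex_algebra_1
begin

lift_definition zero_uea :: "'a uea" is 0 .

lift_definition one_uea :: "'a uea" is 1 .

lift_definition plus_uea :: "'a uea \<Rightarrow> 'a uea \<Rightarrow> 'a uea" is "(+)"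
proof -
  fix p p' q q' :: "'a word \<Rightarrow>\<^sub>0 complex"
  assume "uea_eq p p'" "uea_eq q q'"
  then have "(p - p') + (q - q') \<in> two_sided_ideal uea_relations"
    unfolding uea_eq_def by (rule two_sided_ideal.add)
  then show "uea_eq (p + q) (p' + q')"
    unfolding uea_eq_def by (simp add: algebra_simps)
qed

lift_definition uminus_uea :: "'a uea \<Rightarrow> 'a uea" is uminus
proof -
  fix p p' :: "'a word \<Rightarrow>\<^sub>0 complex"
  assume "uea_eq p p'"
  then have "- (p - p') \<in> two_sided_ideal uea_relations"
    unfolding uea_eq_def by (rule two_sided_ideal_uminus)
  then show "uea_eq (- p) (- p')"
    unfolding uea_eq_def by simp
qed

lift_definition minus_uea :: "'a uea \<Rightarrow> 'a uea \<Rightarrow> 'a uea" is "(-)"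
proof -
  fix p p' q q' :: "'a word \<Rightarrow>\<^sub>0 complex"
  assume "uea_eq p p'" "uea_eq q q'"
  then have "(p - p') - (q - q') \<in> two_sided_ideal uea_relations"
    unfolding uea_eq_def by (rule two_sided_ideal_diff)
  then show "uea_eq (p - q) (p' - q')"
    unfolding uea_eq_def by (simp add: algebra_simps)
qed

lift_definition times_uea :: "'a uea \<Rightarrow> 'a uea \<Rightarrow> 'a uea" is "(*)"
proof -
  fix p p' q q' :: "'a word \<Rightarrow>\<^sub>0 complex"
  assume "uea_eq p p'" "uea_eq q q'"
  then have "(p - p') * q + p' * (q - q') \<in> two_sided_ideal uea_relations"
    unfolding uea_eq_def
    by (intro two_sided_ideal.add two_sided_ideal.mult_left two_sided_ideal.mult_right)
  then show "uea_eq (p * q) (p' * q')"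
    unfolding uea_eq_def by (simp add: algebra_simps)
qed

lift_definition scaleC_uea :: "complex \<Rightarrow> 'a uea \<Rightarrow> 'a uea" is scaleC
proof -
  fix c and p p' :: "'a word \<Rightarrow>\<^sub>0 complex"
  assume "uea_eq p p'"
  then have "c *\<^sub>C (p - p') \<in> two_sided_ideal uea_relations"
    unfolding uea_eq_def by (rule two_sided_ideal_scaleC)
  then show "uea_eq (c *\<^sub>C p) (c *\<^sub>C p')"
    unfolding uea_eq_def by (simp add: complex_vector.scale_right_diff_distrib)
qed

instance
proof
  fix x y z :: "'a uea" and c d :: complex
  have refl: "p = q \<Longrightarrow> uea_eq p q" for p q :: "'a word \<Rightarrow>\<^sub>0 complex"
    by (simp add: uea_eq_def two_sided_ideal.zero)
  show "x + y + z = x + (y + z)" by transfer (rule refl, simp add: algebra_simps)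
  show "x + y = y + x" by transfer (rule refl, simp add: algebra_simps)
  show "0 + x = x" by transfer (rule refl, simp)
  show "- x + x = 0" by transfer (rule refl, simp)
  show "x - y = x + - y" by transfer (rule refl, simp)
  show "x * y * z = x * (y * z)" by transfer (rule refl, simp add: mult.assoc)
  show "(x + y) * z = x * z + y * z" by transfer (rule refl, simp add: distrib_right)
  show "x * (y + z) = x * y + x * z" by transfer (rule refl, simp add: distrib_left)
  show "1 * x = x" by transfer (rule refl, simp)
  show "x * 1 = x" by transfer (rule refl, simp)
  show "c *\<^sub>C (x + y) = c *\<^sub>C x + c *\<^sub>C y" by transfer (rule refl, simp add: scaleC_add_right)
  show "(c + d) *\<^sub>C x = c *\<^sub>C x + d *\<^sub>C x" by transfer (rule refl, simp add: scaleC_add_left)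
  show "c *\<^sub>C (d *\<^sub>C x) = (c * d) *\<^sub>C x" by transfer (rule refl, simp add: scaleC_scaleC)
  show "1 *\<^sub>C x = x" by transfer (rule refl, simp add: scaleC_one)
  show "(c *\<^sub>C x) * y = c *\<^sub>C (x * y)" by transfer (rule refl, simp add: mult_scaleC_left)
  show "x * (c *\<^sub>C y) = c *\<^sub>C (x * y)" by transfer (rule refl, simp add: mult_scaleC_right)
  show "(0::'a uea) \<noteq> 1"
  proof transfer
    let ?e = "falg_lift (\<lambda>_::'a. 0::complex)"
    have "clinear (\<lambda>_::'a. 0::complex)" by (rule clinearI) (auto simp: scaleC_complex_def)
    then have "?e p = 0" if "p \<in> two_sided_ideal uea_relations" for p
      by (intro falg_lift_ideal[OF _ _ that]) auto
    moreover have "?e (0 - 1) = -1"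
      by (simp add: clinear_minus[OF clinear_falg_lift] falg_lift_one)
    ultimately have "(0 - 1 :: 'a word \<Rightarrow>\<^sub>0 complex) \<notin> two_sided_ideal uea_relations"
      by (metis zero_neq_neg_one)
    then show "\<not> uea_eq 0 (1 :: 'a word \<Rightarrow>\<^sub>0 complex)"
      by (simp only: uea_eq_def not_False_eq_True)
  qed
qed

end

lift_definition uea_inj :: "'g::complex_lie_algebra \<Rightarrow> 'g uea" is letter .

text \<open>The algebra map induced by a map \<open>f\<close> of the Lie algebra into an associative algebra;
  meaningful only if \<open>f\<close> is linear and turns brackets into commutators.\<close>

definition uea_lift :: "('g::complex_lie_algebra \<Rightarrow> 'a::complex_algebra_1) \<Rightarrow> 'g uea \<Rightarrow> 'a"
  where "uea_lift f u = falg_lift f (rep_uea u)"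

lemma abs_uea_eqI: "p - q \<in> uea_relations \<Longrightarrow> abs_uea p = abs_uea q"
  by (simp add: uea.abs_eq_iff uea_eq_def two_sided_ideal.base)

lemma clinear_uea_inj: "clinear uea_inj"
proof (rule clinearI)
  fix x y :: 'a and c
  have "abs_uea (letter (x + y)) = abs_uea (letter x + letter y)"
    by (rule abs_uea_eqI, unfold diff_diff_eq[symmetric] uea_relations_def) blast
  then show "uea_inj (x + y) = uea_inj x + uea_inj y"
    by (simp add: uea_inj.abs_eq plus_uea.abs_eq)
  have "abs_uea (letter (c *\<^sub>C x)) = abs_uea (c *\<^sub>C letter x)"
    by (rule abs_uea_eqI) (auto simp: uea_relations_def)
  then show "uea_inj (c *\<^sub>C x) = c *\<^sub>C uea_inj x"
    by (simp add: uea_inj.abs_eq scaleC_uea.abs_eq)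
qed

lemma uea_inj_lie: "uea_inj (lie x y) = uea_inj x * uea_inj y - uea_inj y * uea_inj x"
proof -
  have "abs_uea (letter x * letter y - letter y * letter x) = abs_uea (letter (lie x y))"
    by (rule abs_uea_eqI) (auto simp: uea_relations_def)
  then show ?thesis
    by (simp add: uea_inj.abs_eq times_uea.abs_eq minus_uea.abs_eq)
qed

lemma uea_lift_abs:
  assumes "clinear f" "\<And>x y. f (lie x y) = f x * f y - f y * f x"
  shows "uea_lift f (abs_uea p) = falg_lift f p"
proof -
  have "uea_eq (rep_uea (abs_uea p)) p"
    by (rule Quotient_rep_abs[OF Quotient_uea]) (simp add: uea_eq_def two_sided_ideal.zero)
  then have "falg_lift f (rep_uea (abs_uea p) - p) = 0"
    unfolding uea_eq_def by (rule falg_lift_ideal[OF assms])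
  then show ?thesis by (simp add: uea_lift_def clinear_diff[OF clinear_falg_lift])
qed

lemma uea_lift_inj:
  assumes "clinear f" "\<And>x y. f (lie x y) = f x * f y - f y * f x"
  shows "uea_lift f (uea_inj x) = f x"
  by (simp add: uea_inj.abs_eq uea_lift_abs[OF assms] falg_lift_letter)

lemma algebra_hom_uea_lift:
  assumes "clinear f" "\<And>x y. f (lie x y) = f x * f y - f y * f x"
  shows "algebra_hom (uea_lift f)"
proof -
  note L = uea_lift_abs[OF assms]
  have A: "\<exists>p. u = abs_uea p" for u :: "'a uea"
    by (metis Quotient_abs_rep[OF Quotient_uea])
  show ?thesis
    unfolding algebra_hom_def
  proof (intro conjI allI clinearI)
    fix u v :: "'a uea" and c
    obtain p q where pq: "u = abs_uea p" "v = abs_uea q" using A by blast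
    show "uea_lift f (u + v) = uea_lift f u + uea_lift f v"
      by (simp add: pq plus_uea.abs_eq L clinear_add[OF clinear_falg_lift])
    show "uea_lift f (c *\<^sub>C u) = c *\<^sub>C uea_lift f u"
      by (simp add: pq scaleC_uea.abs_eq L clinear_scaleC[OF clinear_falg_lift])
    show "uea_lift f (u * v) = uea_lift f u * uea_lift f v"
      by (simp add: pq times_uea.abs_eq L falg_lift_mult)
    show "uea_lift f 1 = 1"
      by (simp add: one_uea_def L falg_lift_one)
  qed
qed

definition uea_coproduct :: "'g::complex_lie_algebra uea \<Rightarrow> 'g uea \<otimes> 'g uea"
  where "uea_coproduct = uea_lift (\<lambda>x. uea_inj x \<otimes> 1 + 1 \<otimes> uea_inj x)"

lemma
  fixes x :: "'g::complex_lie_algebra"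
  shows algebra_hom_uea_coproduct: "algebra_hom (uea_coproduct :: 'g uea \<Rightarrow> _)"
    and uea_coproduct_inj: "uea_coproduct (uea_inj x) = uea_inj x \<otimes> 1 + 1 \<otimes> uea_inj x"
proof -
  let ?d = "\<lambda>x::'g. uea_inj x \<otimes> 1 + 1 \<otimes> uea_inj x"
  have 1: "clinear ?d"
    by (rule clinearI) (simp_all add: clinear_add[OF clinear_uea_inj] clinear_scaleC[OF clinear_uea_inj]
        tensor_add_left tensor_add_right tensor_scaleC_left tensor_scaleC_right scaleC_add_right)
  have diff: "(a - b) \<otimes> 1 = a \<otimes> 1 - b \<otimes> 1" "1 \<otimes> (a - b) = 1 \<otimes> a - 1 \<otimes> b" for a b :: "'g uea"
    using cbilinear_tensor by (auto simp: cbilinear_def intro: clinear_diff[of "\<lambda>a. a \<otimes> 1"] clinear_diff)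
  have 2: "?d (lie x y) = ?d x * ?d y - ?d y * ?d x" for x y
    by (simp add: uea_inj_lie diff distrib_left distrib_right tensor_mult_tensor)
  show "algebra_hom (uea_coproduct :: 'g uea \<Rightarrow> _)" "uea_coproduct (uea_inj x) = ?d x"
    using algebra_hom_uea_lift[OF 1 2] uea_lift_inj[OF 1 2] by (simp_all add: uea_coproduct_def)
qed

section \<open>Formal power series with coefficients in a vector space\<close>

text \<open>\<open>V[[h]]\<close> is \<^typ>\<open>'v fps\<close>, with \<open>h\<close>-adic reduction \<open>v \<mapsto> v $ 0\<close>.  For an algebra, the
  product of \<^typ>\<open>'v fps\<close> is the undeformed one.\<close>

instantiation fps :: (complex_vector) complex_vector
begin

definition scaleC_fps :: "complex \<Rightarrow> 'a fps \<Rightarrow> 'a fps"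
  where "scaleC_fps c f = Abs_fps (\<lambda>n. c *\<^sub>C f $ n)"

instance
  by standard (simp_all add: fps_eq_iff scaleC_fps_def scaleC_add_right scaleC_add_left
      scaleC_scaleC scaleC_one)

end

instance fps :: (complex_algebra_1) complex_algebra_1
  by standard (simp_all add: fps_eq_iff scaleC_fps_def fps_mult_nth mult_scaleC_left
      mult_scaleC_right complex_vector.scale_sum_right)

definition fps_scale :: "complex fps \<Rightarrow> 'v::complex_vector fps \<Rightarrow> 'v fps" (infixr \<open>*\<^sub>h\<close> 74)
  where "c *\<^sub>h v = Abs_fps (\<lambda>n. \<Sum>i=0..n. c $ i *\<^sub>C v $ (n - i))"

definition h_linear :: "('v::complex_vector fps \<Rightarrow> 'w::complex_vector fps) \<Rightarrow> bool"
  where "h_linear F \<longleftrightarrow> (\<forall>u v. F (u + v) = F u + F v) \<and> (\<forall>c v. F (c *\<^sub>h v) = c *\<^sub>h F v)"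

definition h_algebra_hom :: "('a::complex_algebra_1 fps \<Rightarrow> 'b::complex_algebra_1 fps) \<Rightarrow> bool"
  where "h_algebra_hom F \<longleftrightarrow> h_linear F \<and> F 1 = 1 \<and> (\<forall>a b. F (a * b) = F a * F b)"

definition fps_apply :: "('v \<Rightarrow> 'w) \<Rightarrow> 'v fps \<Rightarrow> 'w fps"
  where "fps_apply f v = Abs_fps (\<lambda>n. f (v $ n))"

definition fps_tensor :: "'v::complex_vector fps \<Rightarrow> 'w::complex_vector fps \<Rightarrow> ('v \<otimes> 'w) fps"
    (infixr \<open>\<otimes>\<^sub>h\<close> 74)
  where "v \<otimes>\<^sub>h w = Abs_fps (\<lambda>n. \<Sum>i=0..n. v $ i \<otimes> w $ (n - i))"

text \<open>The completed tensor product \<open>F \<otimes> G : (V \<otimes> W)[[h]] \<rightarrow> (V' \<otimes> W')[[h]]\<close> of two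
  \<open>\<complex>[[h]]\<close>-linear maps \<open>F : V[[h]] \<rightarrow> V'[[h]]\<close> and \<open>G : W[[h]] \<rightarrow> W'[[h]]\<close>: the bilinear map
  \<open>(v, w) \<mapsto> F v \<otimes>\<^sub>h G w\<close> on constant series is extended linearly to \<open>V \<otimes> W\<close>, and then
  \<open>h\<close>-adically to \<open>\<Sum>\<^sub>k t\<^sub>k h\<^sup>k\<close>.\<close>

definition fps_tensor_map ::
    "('v::complex_vector fps \<Rightarrow> 'v'::complex_vector fps) \<Rightarrow>
     ('w::complex_vector fps \<Rightarrow> 'w'::complex_vector fps) \<Rightarrow> ('v \<otimes> 'w) fps \<Rightarrow> ('v' \<otimes> 'w') fps"
  where "fps_tensor_map F G t = Abs_fps (\<lambda>n. \<Sum>k=0..n.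
    tensor_lift (\<lambda>v w. F (fps_const v) \<otimes>\<^sub>h G (fps_const w)) (t $ k) $ (n - k))"

lemma clinear_fps_nth: "clinear (\<lambda>v. v $ n)"
  by (rule clinearI) (simp_all add: scaleC_fps_def)

lemma fps_scale_const: "fps_const c *\<^sub>h v = c *\<^sub>C v"
  by (rule fps_ext) (simp add: fps_scale_def scaleC_fps_def if_distrib[of "\<lambda>c. c *\<^sub>C _"]
      complex_vector.scale_zero_left sum.delta cong: if_cong)

lemma fps_scale_X_power: "(fps_X ^ k *\<^sub>h v) $ n = (if n < k then 0 else v $ (n - k))"
  by (simp add: fps_scale_def fps_X_power_nth if_distrib[of "\<lambda>c. c *\<^sub>C _"] scaleC_one
      sum.delta cong: if_cong)

lemma h_linear_add: "h_linear F \<Longrightarrow> F (u + v) = F u + F v"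
  and h_linear_scale: "h_linear F \<Longrightarrow> F (c *\<^sub>h v) = c *\<^sub>h F v"
  by (simp_all add: h_linear_def)

lemma h_linear_imp_clinear:
  assumes "h_linear F"
  shows "clinear F"
  by (rule clinearI)
    (simp_all add: h_linear_add[OF assms] h_linear_scale[OF assms] fps_scale_const[symmetric])

lemma h_linear_nth:
  assumes F: "h_linear F"
  shows "F v $ n = (\<Sum>k=0..n. F (fps_const (v $ k)) $ (n - k))"
proof -
  note L = h_linear_imp_clinear[OF F]
  have "v = (\<Sum>k=0..n. fps_X ^ k *\<^sub>h fps_const (v $ k)) + fps_X ^ Suc n *\<^sub>h fps_shift (Suc n) v"
    (is "_ = ?a + ?b")
  proof (rule fps_ext)
    fix m
    have "(if m < k then 0 else fps_const (v $ k) $ (m - k)) = (if k = m then v $ m else 0)" for k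
      by auto
    then have "?a $ m = (\<Sum>k=0..n. if k = m then v $ m else 0)"
      by (simp only: fps_sum_nth fps_scale_X_power)
    then show "v $ m = (?a + ?b) $ m"
      by (simp del: power_Suc add: fps_scale_X_power)
  qed
  then have "F v = F ?a + F ?b"
    using h_linear_add[OF F, of ?a ?b] by simp
  then have "F v = (\<Sum>k=0..n. fps_X ^ k *\<^sub>h F (fps_const (v $ k))) + fps_X ^ Suc n *\<^sub>h F (fps_shift (Suc n) v)"
    by (simp only: clinear_sum[OF L] h_linear_scale[OF F])
  then show ?thesis
    by (simp del: power_Suc add: fps_sum_nth fps_scale_X_power)
qed

lemma fps_tensor_add_left: "(u + v) \<otimes>\<^sub>h w = u \<otimes>\<^sub>h w + v \<otimes>\<^sub>h w"
  and fps_tensor_add_right: "w \<otimes>\<^sub>h (u' + v') = w \<otimes>\<^sub>h u' + w \<otimes>\<^sub>h v'"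
  by (simp_all add: fps_eq_iff fps_tensor_def tensor_add_left tensor_add_right sum.distrib)

lemma fps_tensor_scale_left: "(c *\<^sub>h v) \<otimes>\<^sub>h w = c *\<^sub>h (v \<otimes>\<^sub>h w)"
proof (rule fps_ext)
  fix n
  have l: "(\<Sum>i\<in>A. f i) \<otimes> w = (\<Sum>i\<in>A. f i \<otimes> w)" for A :: "nat set" and f :: "nat \<Rightarrow> 'a" and w :: 'b
    by (induction A rule: infinite_finite_induct) (simp_all add: tensor_0_left tensor_add_left)
  show "((c *\<^sub>h v) \<otimes>\<^sub>h w) $ n = (c *\<^sub>h (v \<otimes>\<^sub>h w)) $ n"
    using fps_mult_assoc_lemma[where k = n and n = n and f = "\<lambda>i j k. c $ i *\<^sub>C (v $ j \<otimes> w $ k)"]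
    by (simp add: fps_scale_def fps_tensor_def l tensor_scaleC_left complex_vector.scale_sum_right)
qed

lemma fps_tensor_commute: "v \<otimes>\<^sub>h w = fps_apply tensor_flip (w \<otimes>\<^sub>h v)"
proof (rule fps_ext)
  fix n
  have c: "clinear (tensor_flip :: 'b \<otimes> 'a \<Rightarrow> _)"
    unfolding tensor_flip_def by (rule clinear_tensor_lift)
      (simp add: cbilinearI tensor_add_left tensor_add_right tensor_scaleC_left tensor_scaleC_right)
  show "(v \<otimes>\<^sub>h w) $ n = fps_apply tensor_flip (w \<otimes>\<^sub>h v) $ n"
    by (simp add: fps_tensor_def fps_apply_def clinear_sum[OF c] tensor_flip_tensor)
      (subst sum.atLeastAtMost_rev, simp)
qed

lemma fps_apply_scale: "clinear f \<Longrightarrow> fps_apply f (c *\<^sub>h v) = c *\<^sub>h fps_apply f v"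
  by (simp add: fps_eq_iff fps_apply_def fps_scale_def clinear_sum clinear_scaleC)

lemma fps_tensor_scale_right: "v \<otimes>\<^sub>h (c *\<^sub>h w) = c *\<^sub>h (v \<otimes>\<^sub>h w)"
proof -
  have "clinear (tensor_flip :: 'b \<otimes> 'a \<Rightarrow> _)"
    unfolding tensor_flip_def by (rule clinear_tensor_lift)
      (simp add: cbilinearI tensor_add_left tensor_add_right tensor_scaleC_left tensor_scaleC_right)
  then show ?thesis
    by (metis fps_tensor_commute fps_tensor_scale_left fps_apply_scale)
qed

lemma cbilinear_fps_tensor_map:
  assumes F: "h_linear F" and G: "h_linear G"
  shows "cbilinear (\<lambda>v w. F (fps_const v) \<otimes>\<^sub>h G (fps_const w))"
proof -
  have c: "fps_const (c *\<^sub>C x) = fps_const c *\<^sub>h fps_const x" for c and x :: "'x::complex_vector"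
    by (rule fps_ext) (simp add: fps_scale_const scaleC_fps_def)
  show ?thesis
    by (rule cbilinearI)
      (simp_all add: c h_linear_add[OF F] h_linear_add[OF G] h_linear_scale[OF F] h_linear_scale[OF G]
        fps_tensor_add_left fps_tensor_add_right fps_tensor_scale_left fps_tensor_scale_right
        fps_const_add[symmetric] fps_scale_const[symmetric] del: fps_const_add)
qed

lemma h_linear_fps_tensor_map:
  assumes "h_linear F" "h_linear G"
  shows "h_linear (fps_tensor_map F G)"
proof -
  let ?L = "tensor_lift (\<lambda>v w. F (fps_const v) \<otimes>\<^sub>h G (fps_const w))"
  have L: "clinear ?L"
    by (rule clinear_tensor_lift[OF cbilinear_fps_tensor_map[OF assms]])
  have "fps_tensor_map F G (c *\<^sub>h t) $ n = (c *\<^sub>h fps_tensor_map F G t) $ n" for c t n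
    using fps_mult_assoc_lemma[where k = n and n = n and f = "\<lambda>i j k. c $ i *\<^sub>C ?L (t $ j) $ k"]
    by (simp add: fps_tensor_map_def fps_scale_def clinear_sum[OF L] clinear_scaleC[OF L]
        fps_sum_nth clinear_scaleC[OF clinear_fps_nth] complex_vector.scale_sum_right)
  moreover have "fps_tensor_map F G (s + t) = fps_tensor_map F G s + fps_tensor_map F G t" for s t
    by (simp add: fps_eq_iff fps_tensor_map_def clinear_add[OF L] sum.distrib)
  ultimately show ?thesis
    by (simp add: h_linear_def fps_eq_iff)
qed

lemma fps_tensor_map_tensor:
  assumes F: "h_linear F" and G: "h_linear G"
  shows "fps_tensor_map F G (v \<otimes>\<^sub>h w) = F v \<otimes>\<^sub>h G w"
proof (rule fps_ext)
  fix n
  let ?B = "\<lambda>v w. F (fps_const v) \<otimes>\<^sub>h G (fps_const w)"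
  note B = cbilinear_fps_tensor_map[OF F G]
  have hl: "h_linear (\<lambda>v. F v \<otimes>\<^sub>h u)" for u :: "'d fps"
    by (simp add: h_linear_def h_linear_add[OF F] h_linear_scale[OF F] fps_tensor_add_left fps_tensor_scale_left)
  have hr: "h_linear (\<lambda>w. u \<otimes>\<^sub>h G w)" for u :: "'b fps"
    by (simp add: h_linear_def h_linear_add[OF G] h_linear_scale[OF G] fps_tensor_add_right fps_tensor_scale_right)
  have vw: "(v \<otimes>\<^sub>h w) $ k = (\<Sum>i=0..k. v $ i \<otimes> w $ (k - i))" for k
    by (simp add: fps_tensor_def)
  have "(F v \<otimes>\<^sub>h G w) $ n = (\<Sum>j=0..n. \<Sum>i=0..n-j. ?B (v $ j) (w $ i) $ (n - j - i))"
    by (subst h_linear_nth[OF hl], subst h_linear_nth[OF hr], rule refl)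
  also have "\<dots> = (\<Sum>j=0..n. \<Sum>i=0..j. ?B (v $ i) (w $ (j - i)) $ (n - j))"
    by (rule fps_mult_assoc_lemma[where k = n and n = n and f = "\<lambda>i j k. ?B (v $ i) (w $ j) $ k", symmetric])
  also have "\<dots> = fps_tensor_map F G (v \<otimes>\<^sub>h w) $ n"
    by (simp add: fps_tensor_map_def vw clinear_sum[OF clinear_tensor_lift[OF B]]
        tensor_lift_tensor[OF B] fps_sum_nth)
  finally show "fps_tensor_map F G (v \<otimes>\<^sub>h w) $ n = (F v \<otimes>\<^sub>h G w) $ n" ..
qed

section \<open>Quasitriangular deformations\<close>

text \<open>Triple tensor products are identified with right-nested ones through
  \<^const>\<open>tensor_assoc\<close>.\<close>

definition h_bialgebra :: "('a::complex_algebra_1 fps \<Rightarrow> ('a \<otimes> 'a) fps) \<Rightarrow> bool"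
  where "h_bialgebra \<Delta> \<longleftrightarrow>
    h_algebra_hom \<Delta> \<and>
    (\<forall>a. fps_apply tensor_assoc (fps_tensor_map \<Delta> (\<lambda>x. x) (\<Delta> a)) = fps_tensor_map (\<lambda>x. x) \<Delta> (\<Delta> a)) \<and>
    (\<exists>\<epsilon> :: 'a fps \<Rightarrow> complex fps. h_algebra_hom \<epsilon> \<and>
      (\<forall>a. fps_apply tensor_left_unit (fps_tensor_map \<epsilon> (\<lambda>x. x) (\<Delta> a)) = a \<and>
           fps_apply tensor_right_unit (fps_tensor_map (\<lambda>x. x) \<epsilon> (\<Delta> a)) = a))"

definition leg12 :: "('a::complex_algebra_1 \<otimes> 'a) fps \<Rightarrow> ('a \<otimes> 'a \<otimes> 'a) fps"
  where "leg12 t = fps_apply tensor_assoc (t \<otimes>\<^sub>h 1)"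

definition leg23 :: "('a::complex_algebra_1 \<otimes> 'a) fps \<Rightarrow> ('a \<otimes> 'a \<otimes> 'a) fps"
  where "leg23 t = 1 \<otimes>\<^sub>h t"

definition leg13 :: "('a::complex_algebra_1 \<otimes> 'a) fps \<Rightarrow> ('a \<otimes> 'a \<otimes> 'a) fps"
  where "leg13 = fps_apply (tensor_lift (\<lambda>a b. a \<otimes> 1 \<otimes> b))"

definition universal_R_matrix ::
    "('a::complex_algebra_1 fps \<Rightarrow> ('a \<otimes> 'a) fps) \<Rightarrow> ('a \<otimes> 'a) fps \<Rightarrow> bool"
  where "universal_R_matrix \<Delta> R \<longleftrightarrow>
    (\<exists>S. R * S = 1 \<and> S * R = 1) \<and>
    (\<forall>a. R * \<Delta> a = fps_apply tensor_flip (\<Delta> a) * R) \<and>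
    fps_apply tensor_assoc (fps_tensor_map \<Delta> (\<lambda>x. x) R) = leg13 R * leg23 R \<and>
    fps_tensor_map (\<lambda>x. x) \<Delta> R = leg13 R * leg12 R"

definition quasitriangular_deformation ::
    "('g::complex_lie_algebra uea fps \<Rightarrow> ('g uea \<otimes> 'g uea) fps) \<Rightarrow> ('g uea \<otimes> 'g uea) fps \<Rightarrow> bool"
  where "quasitriangular_deformation \<Delta> R \<longleftrightarrow>
    h_bialgebra \<Delta> \<and> universal_R_matrix \<Delta> R \<and>
    (\<forall>a. \<Delta> a $ 0 = uea_coproduct (a $ 0)) \<and> R $ 0 = 1"

end

theory Submission
  imports Defs
begin

text \<open>The element \<open>c\<close> is built degree by degree in \<open>h\<close>.  If \<open>E = 1 + h\<^sup>n e + \<dots>\<close>, then reducing the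
  hypotheses on \<open>E\<close> to order \<open>h\<^sup>n\<close> shows that \<open>e \<in> U\<gg> \<otimes> U\<gg>\<close> is a symmetric, invariant 2-cocycle
  of the undeformed coalgebra \<open>U\<gg>\<close>.  Such a cocycle is the coboundary
  \<open>x \<otimes> 1 + 1 \<otimes> x - \<Delta>\<^sub>0(x)\<close> of a central \<open>x\<close>
  (\<open>symmetric_invariant_cocycle_is_coboundary\<close>), so \<open>y = 1 + h\<^sup>n x\<close> is central and
  \<open>E \<Delta>(y) = y \<otimes> y\<close> holds up to order \<open>n\<close> inclusively.  Replacing \<open>E\<close> by \<open>E \<Delta>(y) (y \<otimes> y)\<^sup>-\<^sup>1\<close>
  preserves the hypotheses (\<open>symmetric_cocycle_gauge\<close>) and moves the first nontrivial term one degree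
  up; the infinite product of the elements \<open>y\<close> is \<open>c\<close>.

  The undeformed statement is proved directly, without the Poincare-Birkhoff-Witt theorem.  Think of
  \<open>U\<gg>\<close> as the functions on a formal group and of \<open>e\<close> as a function \<open>e(a, b)\<close> of two
  points; points with values in an algebra are unital linear maps on \<open>U\<gg>\<close>, and they are multiplied
  by convolution.  As for 2-cocycles of abelian groups, the cocycle condition and symmetry give
  \<open>e(a, b) + e(a b, c d) + e(c, d) = e(a, c) + e(a c, b d) + e(b, d)\<close>
  whenever \<open>b\<close> and \<open>c\<close> commute (\<open>cocycle_exchange\<close>).  For \<open>c = a\<close>, \<open>d = b\<close> the two generic
  points this reads
  \<open>2 e - (\<psi> \<otimes> \<psi>) e = f \<otimes> 1 + 1 \<otimes> f - \<Delta>\<^sub>0(f)\<close>,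
  where \<open>f = \<mu>(e)\<close> is the restriction to the diagonal and \<open>\<psi> = \<mu> \<circ> \<Delta>\<^sub>0\<close> is the squaring map
  (\<open>cocycle_adams\<close>).  Since \<open>\<psi> \<otimes> \<psi>\<close> acts as \<open>2\<^sup>n\<close> in degree \<open>n\<close> of the word-length
  filtration modulo lower degree (\<open>adams_tensor_filt\<close>), subtracting from \<open>e\<close> the coboundary of
  \<open>f / (2 - 2\<^sup>n)\<close> lowers the degree of \<open>e\<close> as long as \<open>n \<ge> 2\<close>.  A cocycle of degree at most 1 is a scalar by the
  counit axioms (\<open>cocycle_degree_one\<close>).  Invariance of \<open>e\<close> makes \<open>f\<close> central, which is why the
  coboundary can be chosen central.\<close>

section \<open>Linear maps into an algebra\<close>

lemma clinear_mult_left: "clinear (\<lambda>u::'a::complex_algebra_1. a * u)"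
  by (rule clinearI) (simp_all add: distrib_left mult_scaleC_right)

lemma clinear_mult_right: "clinear (\<lambda>u::'a::complex_algebra_1. u * a)"
  by (rule clinearI) (simp_all add: distrib_right mult_scaleC_left)

lemma clinear_plus: "clinear f \<Longrightarrow> clinear g \<Longrightarrow> clinear (\<lambda>u. f u + g u)"
  by (rule clinearI) (simp_all add: clinear_add clinear_scaleC scaleC_add_right)

lemma clinear_minus_fun: "clinear f \<Longrightarrow> clinear g \<Longrightarrow> clinear (\<lambda>u. f u - g u)"
  by (rule clinearI)
    (simp_all add: clinear_add clinear_scaleC complex_vector.scale_right_diff_distrib)

lemma clinear_scale_fun: "clinear f \<Longrightarrow> clinear (\<lambda>u. c *\<^sub>C f u)"
  by (rule clinearI)
    (simp_all add: clinear_add clinear_scaleC scaleC_add_right scaleC_scaleC mult.commute)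

lemma clinear_tensor_left: "clinear (\<lambda>a. a \<otimes> b)"
  and clinear_tensor_right: "clinear (\<lambda>b. a \<otimes> b)"
  using cbilinear_tensor by (auto simp: cbilinear_def)

lemmas tensor_diff_left = clinear_diff[OF clinear_tensor_left]
  and tensor_diff_right = clinear_diff[OF clinear_tensor_right]

lemma clinear_tensor_flip: "clinear tensor_flip"
  unfolding tensor_flip_def by (rule clinear_tensor_lift)
    (simp add: cbilinearI tensor_add_left tensor_add_right tensor_scaleC_left tensor_scaleC_right)

lemma clinear_tensor_assoc: "clinear tensor_assoc"
proof -
  have b: "cbilinear (\<lambda>a b. a \<otimes> b \<otimes> c)" for c :: "'c::complex_vector"
    by (simp add: cbilinearI tensor_add_left tensor_add_right tensor_scaleC_left tensor_scaleC_right)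
  have "cbilinear (\<lambda>s c. tensor_lift (\<lambda>a b. (a::'a::complex_vector) \<otimes> (b::'b::complex_vector) \<otimes> (c::'c)) s)"
    by (rule cbilinearI)
      (simp_all add: clinear_add[OF clinear_tensor_lift[OF b]] clinear_scaleC[OF clinear_tensor_lift[OF b]]
        tensor_add_right tensor_scaleC_right tensor_lift_add_fun tensor_lift_scaleC_fun)
  then show ?thesis
    unfolding tensor_assoc_def by (rule clinear_tensor_lift)
qed

text \<open>On \<open>e \<in> A \<otimes> B\<close> this is the value of the function \<open>e\<close> at the pair of points \<open>(f, g)\<close> with
  values in the algebra \<open>C\<close>.  Multiplication, the identity and the maps that evaluate triple tensors
  are all instances.\<close>

definition mult_lift :: "('a::complex_vector \<Rightarrow> 'c::complex_algebra_1) \<Rightarrow>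
    ('b::complex_vector \<Rightarrow> 'c) \<Rightarrow> 'a \<otimes> 'b \<Rightarrow> 'c"
  where "mult_lift f g = tensor_lift (\<lambda>a b. f a * g b)"

lemma
  assumes "clinear f" "clinear g"
  shows mult_lift_tensor: "mult_lift f g (a \<otimes> b) = f a * g b"
    and clinear_mult_lift: "clinear (mult_lift f g)"
proof -
  have "cbilinear (\<lambda>a b. f a * g b)"
    by (rule cbilinearI) (simp_all add: assms clinear_add clinear_scaleC distrib_left distrib_right
        mult_scaleC_left mult_scaleC_right)
  then show "mult_lift f g (a \<otimes> b) = f a * g b" "clinear (mult_lift f g)"
    unfolding mult_lift_def by (rule tensor_lift_tensor, rule clinear_tensor_lift)
qed

lemma mult_lift_legs: "mult_lift (\<lambda>a. a \<otimes> 1) (\<lambda>b. 1 \<otimes> b) t = t"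
  by (rule tensor_lift_unique)
    (simp_all add: mult_lift_tensor clinear_mult_lift clinear_tensor_left clinear_tensor_right
      clinear_ident tensor_mult_tensor)

lemma mult_lift_compose_hom:
  assumes "algebra_hom F" "clinear f" "clinear g"
  shows "mult_lift (\<lambda>a. F (f a)) (\<lambda>b. F (g b)) t = F (mult_lift f g t)"
proof -
  have F: "clinear F" "\<And>a b. F (a * b) = F a * F b"
    using assms(1) by (auto simp: algebra_hom_def)
  note Ff = clinear_compose[OF assms(2) F(1)] and Fg = clinear_compose[OF assms(3) F(1)]
  show ?thesis
    by (rule tensor_lift_unique[OF clinear_mult_lift[OF Ff Fg]
          clinear_compose[OF clinear_mult_lift[OF assms(2,3)] F(1)]])
      (simp add: mult_lift_tensor Ff Fg assms(2,3) F(2))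
qed

lemma mult_lift_flip:
  assumes "clinear f" "clinear g" "\<And>a b. f a * g b = g b * f a"
  shows "mult_lift f g t = mult_lift g f (tensor_flip t)"
  by (rule tensor_lift_unique[OF clinear_mult_lift[OF assms(1,2)]
        clinear_compose[OF clinear_tensor_flip clinear_mult_lift[OF assms(2,1)]]])
    (simp add: assms mult_lift_tensor tensor_flip_tensor)

lemma mult_lift_assoc:
  assumes f: "clinear f" and g: "clinear g" and h: "clinear h"
  shows "mult_lift f (mult_lift g h) (tensor_assoc (t \<otimes> c)) = mult_lift f g t * h c"
proof (rule tensor_lift_unique[where F = "\<lambda>t. mult_lift f (mult_lift g h) (tensor_assoc (t \<otimes> c))"])
  show "clinear (\<lambda>t. mult_lift f (mult_lift g h) (tensor_assoc (t \<otimes> c)))"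
    by (intro clinear_compose[OF clinear_compose[OF clinear_tensor_left clinear_tensor_assoc]]
        clinear_mult_lift f g h)
  show "clinear (\<lambda>t. mult_lift f g t * h c)"
    by (intro clinear_compose[OF _ clinear_mult_right] clinear_mult_lift f g)
qed (simp add: tensor_assoc_tensor mult_lift_tensor clinear_mult_lift f g h mult.assoc)

definition tensor_map :: "('a::complex_vector \<Rightarrow> 'c::complex_vector) \<Rightarrow>
    ('b::complex_vector \<Rightarrow> 'd::complex_vector) \<Rightarrow> 'a \<otimes> 'b \<Rightarrow> 'c \<otimes> 'd"
  where "tensor_map f g = tensor_lift (\<lambda>a b. f a \<otimes> g b)"

lemma
  assumes "clinear f" "clinear g"
  shows tensor_map_tensor: "tensor_map f g (a \<otimes> b) = f a \<otimes> g b"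
    and clinear_tensor_map: "clinear (tensor_map f g)"
proof -
  have "cbilinear (\<lambda>a b. f a \<otimes> g b)"
    by (rule cbilinearI) (simp_all add: assms clinear_add clinear_scaleC
        tensor_add_left tensor_add_right tensor_scaleC_left tensor_scaleC_right)
  then show "tensor_map f g (a \<otimes> b) = f a \<otimes> g b" "clinear (tensor_map f g)"
    unfolding tensor_map_def by (rule tensor_lift_tensor, rule clinear_tensor_lift)
qed

lemma algebra_hom_tensorI:
  fixes F :: "'a::complex_algebra_1 \<otimes> 'b::complex_algebra_1 \<Rightarrow> 'c::complex_algebra_1"
  assumes F: "clinear F" and one: "F (1 \<otimes> 1) = 1"
    and mult: "\<And>a b a' b'. F ((a * a') \<otimes> (b * b')) = F (a \<otimes> b) * F (a' \<otimes> b')"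
  shows "algebra_hom F"
proof -
  have "F ((a \<otimes> b) * t) = F (a \<otimes> b) * F t" for a b t
    by (induction t rule: tensor_induct)
      (simp_all add: clinear_0[OF F] clinear_add[OF F] distrib_left tensor_mult_tensor mult)
  then have "F (s * t) = F s * F t" for s t
    by (induction s rule: tensor_induct)
      (simp_all add: clinear_0[OF F] clinear_add[OF F] distrib_right)
  then show ?thesis
    using F one by (simp add: algebra_hom_def one_tensor_def)
qed

lemma algebra_hom_tensor_flip:
  "algebra_hom (tensor_flip :: 'a::complex_algebra_1 \<otimes> 'b::complex_algebra_1 \<Rightarrow> _)"
  by (rule algebra_hom_tensorI)
    (simp_all add: clinear_tensor_flip tensor_flip_tensor tensor_mult_tensor one_tensor_def)

lemma algebra_hom_tensor_map:
  assumes "algebra_hom f" "algebra_hom g"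
  shows "algebra_hom (tensor_map f g)"
  using assms by (intro algebra_hom_tensorI)
    (auto simp: algebra_hom_def clinear_tensor_map tensor_map_tensor tensor_mult_tensor one_tensor_def)

lemma algebra_hom_tensor_assoc:
  "algebra_hom (tensor_assoc :: ('a::complex_algebra_1 \<otimes> 'b::complex_algebra_1) \<otimes> 'c::complex_algebra_1 \<Rightarrow> _)"
proof (rule algebra_hom_tensorI)
  let ?A = "tensor_assoc :: ('a \<otimes> 'b) \<otimes> 'c \<Rightarrow> _"
  show "clinear ?A" by (rule clinear_tensor_assoc)
  show "?A (1 \<otimes> 1) = 1" by (simp add: one_tensor_def tensor_assoc_tensor)
  fix s t :: "'a \<otimes> 'b" and c d :: 'c
  have lin: "clinear (\<lambda>s. ?A (s \<otimes> c))" for c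
    by (rule clinear_compose[OF clinear_tensor_left clinear_tensor_assoc])
  have pure: "?A (((a \<otimes> b) * t) \<otimes> (c * d)) = ?A ((a \<otimes> b) \<otimes> c) * ?A (t \<otimes> d)" for a b
    by (induction t rule: tensor_induct)
      (simp_all add: clinear_0[OF lin] clinear_add[OF lin] distrib_left tensor_mult_tensor
        tensor_assoc_tensor)
  show "?A ((s * t) \<otimes> (c * d)) = ?A (s \<otimes> c) * ?A (t \<otimes> d)"
    by (induction s rule: tensor_induct)
      (simp_all add: clinear_0[OF lin] clinear_add[OF lin] distrib_right pure)
qed

lemma algebra_hom_leg1: "algebra_hom (\<lambda>a::'a::complex_algebra_1. a \<otimes> (1::'b::complex_algebra_1))"
  and algebra_hom_leg2: "algebra_hom (\<lambda>b::'b::complex_algebra_1. (1::'a::complex_algebra_1) \<otimes> b)"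
  by (simp_all add: algebra_hom_def tensor_mult_tensor one_tensor_def clinear_tensor_left
      clinear_tensor_right)

lemma algebra_hom_compose: "algebra_hom f \<Longrightarrow> algebra_hom g \<Longrightarrow> algebra_hom (\<lambda>a. g (f a))"
  by (auto simp: algebra_hom_def clinear_compose)

lemma algebra_hom_ident: "algebra_hom (\<lambda>a. a)"
  by (simp add: algebra_hom_def clinear_ident)

section \<open>Coalgebra structure of the enveloping algebra\<close>

definition uea_word :: "'g::complex_lie_algebra list \<Rightarrow> 'g uea"
  where "uea_word xs = prod_list (map uea_inj xs)"

lemma uea_word_simps [simp]:
  "uea_word [] = 1" "uea_word (x # xs) = uea_inj x * uea_word xs"
  "uea_word (xs @ ys) = uea_word xs * uea_word ys"
  by (simp_all add: uea_word_def)

lemma abs_uea_single_word: "abs_uea (Poly_Mapping.single w c) = c *\<^sub>C uea_word (letters w)"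
proof -
  have "abs_uea (Poly_Mapping.single (Word xs) 1) = uea_word xs" for xs :: "'a list"
  proof (induction xs)
    case Nil
    show ?case by (simp add: one_uea_def flip: zero_word_def)
  next
    case (Cons x xs)
    have "Poly_Mapping.single (Word (x # xs)) (1::complex)
        = letter x * Poly_Mapping.single (Word xs) 1"
      by (simp add: letter_def mult_single plus_word_def)
    then show ?case
      using Cons by (simp add: times_uea.abs_eq[symmetric] uea_inj.abs_eq)
  qed
  from this[of "letters w"] have "abs_uea (c *\<^sub>C Poly_Mapping.single w 1) = c *\<^sub>C uea_word (letters w)"
    by (simp add: scaleC_uea.abs_eq[symmetric])
  then show ?thesis
    by (simp add: scaleC_single scaleC_complex_def)
qed

lemma span_uea_word: "u \<in> complex_vector.span (range uea_word)"
proof -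
  have "abs_uea p \<in> complex_vector.span (range uea_word)" for p :: "'a word \<Rightarrow>\<^sub>0 complex"
  proof (induction p rule: poly_mapping_single_induct)
    case zero
    show ?case by (simp add: complex_vector.span_zero flip: zero_uea_def)
  next
    case (add w c p)
    then show ?case
      by (simp add: plus_uea.abs_eq[symmetric] abs_uea_single_word complex_vector.span_add
          complex_vector.span_scale complex_vector.span_base)
  qed
  then show ?thesis
    by (metis Quotient_abs_rep[OF Quotient_uea])
qed

lemma clinear_zero_on_span:
  assumes "clinear F" "\<And>x. x \<in> S \<Longrightarrow> F x = 0" "x \<in> complex_vector.span S"
  shows "F x = 0"
  using assms(3)
  by (induction rule: complex_vector.span_induct_alt)
    (simp_all add: assms clinear_0[OF assms(1)] clinear_add[OF assms(1)] clinear_scaleC[OF assms(1)])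

lemma clinear_into_span:
  assumes "clinear F" "\<And>x. x \<in> S \<Longrightarrow> F x \<in> complex_vector.span T" "x \<in> complex_vector.span S"
  shows "F x \<in> complex_vector.span T"
  using assms(3)
  by (induction rule: complex_vector.span_induct_alt)
    (simp_all add: assms(2) clinear_0[OF assms(1)] clinear_add[OF assms(1)] clinear_scaleC[OF assms(1)]
      complex_vector.span_zero complex_vector.span_add complex_vector.span_scale)

text \<open>Words span the enveloping algebra, so a homomorphism is determined by its values on the Lie
  algebra; this yields the coalgebra axioms.\<close>

lemma algebra_hom_uea_eqI:
  assumes "algebra_hom F" "algebra_hom G" "\<And>x. F (uea_inj x) = G (uea_inj x)"
  shows "F u = G u"
proof -
  have F: "clinear F" "F 1 = 1" "\<And>a b. F (a * b) = F a * F b"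
    and G: "clinear G" "G 1 = 1" "\<And>a b. G (a * b) = G a * G b"
    using assms by (auto simp: algebra_hom_def)
  have "F (uea_word xs) - G (uea_word xs) = 0" for xs
    by (induction xs) (simp_all add: F G assms(3))
  then have "F u - G u = 0"
    using clinear_zero_on_span[OF clinear_minus_fun[OF F(1) G(1)] _ span_uea_word] by blast
  then show ?thesis by simp
qed

lemma clinear_uea_coproduct: "clinear uea_coproduct"
  and uea_coproduct_one: "uea_coproduct 1 = 1"
  and uea_coproduct_mult: "uea_coproduct (a * b) = uea_coproduct a * uea_coproduct b"
  using algebra_hom_uea_coproduct by (auto simp: algebra_hom_def)

lemma uea_coproduct_cocommutative: "tensor_flip (uea_coproduct u) = uea_coproduct u"
  by (rule algebra_hom_uea_eqI[OF algebra_hom_compose[OF algebra_hom_uea_coproduct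
        algebra_hom_tensor_flip] algebra_hom_uea_coproduct])
    (simp add: uea_coproduct_inj clinear_add[OF clinear_tensor_flip] tensor_flip_tensor)

lemma uea_coproduct_coassociative:
  "tensor_assoc (tensor_map uea_coproduct (\<lambda>x. x) (uea_coproduct u))
    = tensor_map (\<lambda>x. x) uea_coproduct (uea_coproduct u)"
proof (rule algebra_hom_uea_eqI)
  note l = clinear_tensor_map[OF clinear_uea_coproduct clinear_ident]
    clinear_tensor_map[OF clinear_ident clinear_uea_coproduct]
  note t = tensor_map_tensor[OF clinear_uea_coproduct clinear_ident]
    tensor_map_tensor[OF clinear_ident clinear_uea_coproduct]
  show "tensor_assoc (tensor_map uea_coproduct (\<lambda>x. x) (uea_coproduct (uea_inj x)))
    = tensor_map (\<lambda>x. x) uea_coproduct (uea_coproduct (uea_inj x))" for x :: 'a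
    by (simp add: uea_coproduct_inj uea_coproduct_one l[THEN clinear_add] t one_tensor_def
        clinear_add[OF clinear_tensor_assoc] tensor_add_left tensor_add_right tensor_assoc_tensor
        add.assoc)
  note D = algebra_hom_uea_coproduct
  show "algebra_hom (\<lambda>u. tensor_assoc (tensor_map uea_coproduct (\<lambda>x. x) (uea_coproduct u)))"
    by (rule algebra_hom_compose[OF algebra_hom_compose[OF D algebra_hom_tensor_map[OF D algebra_hom_ident]]
        algebra_hom_tensor_assoc])
  show "algebra_hom (\<lambda>u. tensor_map (\<lambda>x. x) uea_coproduct (uea_coproduct u))"
    by (rule algebra_hom_compose[OF D algebra_hom_tensor_map[OF algebra_hom_ident D]])
qed

definition uea_counit :: "'g::complex_lie_algebra uea \<Rightarrow> complex"
  where "uea_counit = uea_lift (\<lambda>_. 0)"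

lemma
  fixes x :: "'g::complex_lie_algebra"
  shows algebra_hom_uea_counit: "algebra_hom (uea_counit :: 'g uea \<Rightarrow> complex)"
    and uea_counit_inj: "uea_counit (uea_inj x) = 0"
proof -
  have 1: "clinear (\<lambda>_::'g. 0::complex)"
    by (rule clinearI) (auto simp: scaleC_complex_def)
  show "algebra_hom (uea_counit :: 'g uea \<Rightarrow> complex)" "uea_counit (uea_inj x) = 0"
    using algebra_hom_uea_lift[OF 1] uea_lift_inj[OF 1] by (simp_all add: uea_counit_def)
qed


section \<open>Symmetric cocycles and convolution\<close>

definition convolution :: "('g::complex_lie_algebra uea \<Rightarrow> 'c::complex_algebra_1) \<Rightarrow> ('g uea \<Rightarrow> 'c) \<Rightarrow> 'g uea \<Rightarrow> 'c"
  where "convolution f g u = mult_lift f g (uea_coproduct u)"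

text \<open>The degree 2 cocycle condition of the cobar complex of the coalgebra \<open>U\<gg>\<close>.\<close>

definition uea_cocycle :: "'g::complex_lie_algebra uea \<otimes> 'g uea \<Rightarrow> bool"
  where "uea_cocycle e \<longleftrightarrow> tensor_assoc (e \<otimes> 1) + tensor_assoc (tensor_map uea_coproduct (\<lambda>x. x) e)
    = 1 \<otimes> e + tensor_map (\<lambda>x. x) uea_coproduct e"

lemma clinear_convolution:
  assumes "clinear f" "clinear g"
  shows "clinear (convolution f g)"
  using clinear_compose[OF clinear_uea_coproduct clinear_mult_lift[OF assms]]
  by (simp add: convolution_def[abs_def])

lemma convolution_one:
  assumes "clinear f" "clinear g"
  shows "convolution f g 1 = f 1 * g 1"
  by (simp add: convolution_def uea_coproduct_one one_tensor_def mult_lift_tensor assms)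

lemma convolution_commute:
  assumes "clinear f" "clinear g" "\<And>a b. f a * g b = g b * f a"
  shows "convolution f g = convolution g f"
  by (rule ext) (simp add: convolution_def mult_lift_flip[OF assms] uea_coproduct_cocommutative)

lemma mult_lift_coproduct_left:
  assumes f: "clinear f" and g: "clinear g" and h: "clinear h"
  shows "mult_lift f (mult_lift g h) (tensor_assoc (tensor_map uea_coproduct (\<lambda>x. x) t))
    = mult_lift (convolution f g) h t"
proof (rule tensor_lift_unique[where G = "mult_lift (convolution f g) h"])
  show "clinear (\<lambda>t. mult_lift f (mult_lift g h) (tensor_assoc (tensor_map uea_coproduct (\<lambda>x. x) t)))"
    by (rule clinear_compose[OF clinear_compose[OF clinear_tensor_map[OF clinear_uea_coproduct clinear_ident]
          clinear_tensor_assoc] clinear_mult_lift[OF f clinear_mult_lift[OF g h]]])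
  show "clinear (mult_lift (convolution f g) h)"
    by (rule clinear_mult_lift[OF clinear_convolution[OF f g] h])
qed (simp add: tensor_map_tensor clinear_uea_coproduct clinear_ident mult_lift_assoc f g h
    mult_lift_tensor clinear_convolution, simp add: convolution_def)

lemma mult_lift_coproduct_right:
  assumes f: "clinear f" and g: "clinear g" and h: "clinear h"
  shows "mult_lift f (mult_lift g h) (tensor_map (\<lambda>x. x) uea_coproduct t)
    = mult_lift f (convolution g h) t"
proof (rule tensor_lift_unique[where G = "mult_lift f (convolution g h)"])
  show "clinear (\<lambda>t. mult_lift f (mult_lift g h) (tensor_map (\<lambda>x. x) uea_coproduct t))"
    by (rule clinear_compose[OF clinear_tensor_map[OF clinear_ident clinear_uea_coproduct]
          clinear_mult_lift[OF f clinear_mult_lift[OF g h]]])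
  show "clinear (mult_lift f (convolution g h))"
    by (rule clinear_mult_lift[OF f clinear_convolution[OF g h]])
qed (simp add: tensor_map_tensor clinear_uea_coproduct clinear_ident f g h
    mult_lift_tensor clinear_mult_lift clinear_convolution, simp add: convolution_def)

lemma convolution_assoc:
  assumes f: "clinear f" and g: "clinear g" and h: "clinear h"
  shows "convolution (convolution f g) h = convolution f (convolution g h)"
  by (rule ext) (simp add: convolution_def[of _ h] convolution_def[of f "convolution g h"]
      mult_lift_coproduct_left[OF assms, symmetric] mult_lift_coproduct_right[OF assms, symmetric]
      uea_coproduct_coassociative)

text \<open>The cocycle identity evaluated at the points \<open>f\<close>, \<open>g\<close>, \<open>h\<close>: it has the shape
  \<open>e(f, g) + e(f g, h) = e(g, h) + e(f, g h)\<close> of a group cocycle.  Unitality of \<open>f\<close> and \<open>h\<close> is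
  what makes the terms \<open>1 \<otimes> e\<close> and \<open>e \<otimes> 1\<close> evaluate correctly.\<close>

lemma cocycle_convolution:
  assumes e: "uea_cocycle e" and f: "clinear f" "f 1 = 1" and g: "clinear g" and h: "clinear h" "h 1 = 1"
  shows "mult_lift f g e + mult_lift (convolution f g) h e = mult_lift g h e + mult_lift f (convolution g h) e"
proof -
  let ?L = "mult_lift f (mult_lift g h)"
  have L: "clinear ?L"
    by (rule clinear_mult_lift[OF f(1) clinear_mult_lift[OF g h(1)]])
  have "?L (tensor_assoc (e \<otimes> 1)) + ?L (tensor_assoc (tensor_map uea_coproduct (\<lambda>x. x) e))
      = ?L (1 \<otimes> e) + ?L (tensor_map (\<lambda>x. x) uea_coproduct e)"
    using e unfolding uea_cocycle_def by (simp add: clinear_add[OF L, symmetric])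
  then show ?thesis
    by (simp add: mult_lift_assoc mult_lift_coproduct_left mult_lift_coproduct_right
        mult_lift_tensor clinear_mult_lift f g h)
qed

text \<open>Two applications of the cocycle identity turn the left-hand side into
  \<open>e(q, r) + e(q r, s) + e(p, q r s)\<close>, which is unchanged when the commuting points \<open>q\<close> and \<open>r\<close>
  are swapped.\<close>

lemma cocycle_exchange:
  assumes e: "uea_cocycle e" "tensor_flip e = e"
    and p: "clinear p" "p 1 = 1" and q: "clinear q" "q 1 = 1"
    and r: "clinear r" "r 1 = 1" and s: "clinear s" "s 1 = 1"
    and comm: "\<And>a b. q a * r b = r b * q a"
  shows "mult_lift p q e + mult_lift (convolution p q) (convolution r s) e + mult_lift r s e
    = mult_lift p r e + mult_lift (convolution p r) (convolution q s) e + mult_lift q s e"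
proof -
  have *: "mult_lift p q e + mult_lift (convolution p q) (convolution r s) e + mult_lift r s e
    = mult_lift q r e + mult_lift (convolution q r) s e + mult_lift p (convolution (convolution q r) s) e"
    if q: "clinear q" "q 1 = 1" and r: "clinear r" "r 1 = 1" for q r
  proof -
    have "mult_lift p q e + mult_lift (convolution p q) (convolution r s) e
        = mult_lift q (convolution r s) e + mult_lift p (convolution (convolution q r) s) e"
      unfolding convolution_assoc[OF q(1) r(1) s(1)]
      by (rule cocycle_convolution[OF e(1) p q(1)])
        (simp_all add: clinear_convolution convolution_one r s)
    moreover have "mult_lift q r e + mult_lift (convolution q r) s e
        = mult_lift r s e + mult_lift q (convolution r s) e"
      by (rule cocycle_convolution[OF e(1) q r(1) s])
    ultimately show ?thesis
      by (simp add: algebra_simps)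
  qed
  have "mult_lift q r e = mult_lift r q e"
    using mult_lift_flip[OF q(1) r(1) comm, of e] e(2) by simp
  moreover have "convolution q r = convolution r q"
    by (rule convolution_commute[OF q(1) r(1) comm])
  ultimately show ?thesis
    using *[OF q r] *[OF r q] by simp
qed

abbreviation uea_mult :: "'g::complex_lie_algebra uea \<otimes> 'g uea \<Rightarrow> 'g uea"
  where "uea_mult \<equiv> mult_lift (\<lambda>x. x) (\<lambda>x. x)"

text \<open>The second Adams operation, which is squaring in the formal group.\<close>

definition adams :: "'g::complex_lie_algebra uea \<Rightarrow> 'g uea"
  where "adams = convolution (\<lambda>x. x) (\<lambda>x. x)"

lemmas clinear_uea_mult = clinear_mult_lift[OF clinear_ident clinear_ident]
  and uea_mult_tensor = mult_lift_tensor[OF clinear_ident clinear_ident]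

lemma clinear_adams: "clinear adams"
  unfolding adams_def by (rule clinear_convolution[OF clinear_ident clinear_ident])

text \<open>The exchange identity for \<open>p = r\<close> the first leg and \<open>q = s\<close> the second leg of
  \<open>U\<gg> \<otimes> U\<gg>\<close>; the two legs commute, and their convolution is the coproduct.\<close>

lemma cocycle_adams:
  fixes e :: "'g::complex_lie_algebra uea \<otimes> 'g uea"
  assumes "uea_cocycle e" "tensor_flip e = e"
  shows "2 *\<^sub>C e - tensor_map adams adams e
    = uea_mult e \<otimes> 1 + 1 \<otimes> uea_mult e - uea_coproduct (uea_mult e)"
proof -
  let ?l = "\<lambda>a::'g uea. a \<otimes> (1::'g uea)" and ?r = "\<lambda>b::'g uea. (1::'g uea) \<otimes> b"
  note lin = clinear_tensor_left[of "1::'g uea"] clinear_tensor_right[of "1::'g uea"]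
  note legs = algebra_hom_leg1[where 'a = "'g uea" and 'b = "'g uea"]
    algebra_hom_leg2[where 'a = "'g uea" and 'b = "'g uea"]
  have lr: "convolution ?l ?r = uea_coproduct"
    by (rule ext) (simp add: convolution_def mult_lift_legs)
  have ll: "convolution ?l ?l = (\<lambda>a. ?l (adams a))" and rr: "convolution ?r ?r = (\<lambda>b. ?r (adams b))"
    using mult_lift_compose_hom[OF legs(1) clinear_ident clinear_ident]
      mult_lift_compose_hom[OF legs(2) clinear_ident clinear_ident]
    by (auto simp: fun_eq_iff convolution_def adams_def)
  have "mult_lift ?l ?r e + mult_lift (convolution ?l ?r) (convolution ?l ?r) e + mult_lift ?l ?r e
    = mult_lift ?l ?l e + mult_lift (convolution ?l ?l) (convolution ?r ?r) e + mult_lift ?r ?r e"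
    by (rule cocycle_exchange[OF assms]) (simp_all add: lin one_tensor_def tensor_mult_tensor)
  moreover have "mult_lift ?l ?l e = ?l (uea_mult e)" "mult_lift ?r ?r e = ?r (uea_mult e)"
    using mult_lift_compose_hom[OF legs(1) clinear_ident clinear_ident]
      mult_lift_compose_hom[OF legs(2) clinear_ident clinear_ident] by simp_all
  moreover have "mult_lift uea_coproduct uea_coproduct e = uea_coproduct (uea_mult e)"
    by (rule mult_lift_compose_hom[OF algebra_hom_uea_coproduct clinear_ident clinear_ident])
  moreover have "mult_lift (\<lambda>a. ?l (adams a)) (\<lambda>b. ?r (adams b)) e = tensor_map adams adams e"
    by (simp add: mult_lift_def tensor_map_def tensor_mult_tensor)
  moreover have "2 *\<^sub>C e = e + e"
    using scaleC_add_left[of 1 1 e] by (simp add: scaleC_one)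
  ultimately show ?thesis
    by (simp add: lr ll rr mult_lift_legs algebra_simps)
qed

section \<open>The word-length filtration\<close>

text \<open>The bound on the length is strict, so that \<open>uea_filt n\<close> consists of the elements of degree less
  than \<open>n\<close> and the error term of an identity in degree 0 lies in \<open>uea_filt 0 = {0}\<close>; the same
  convention is used for \<open>U\<gg> \<otimes> U\<gg>\<close>.\<close>

definition uea_filt :: "nat \<Rightarrow> 'g::complex_lie_algebra uea set"
  where "uea_filt n = complex_vector.span {uea_word xs | xs. length xs < n}"

definition uea2_filt :: "nat \<Rightarrow> ('g::complex_lie_algebra uea \<otimes> 'g uea) set"
  where "uea2_filt n = complex_vector.span {uea_word xs \<otimes> uea_word ys | xs ys. length xs + length ys < n}"

lemma uea_word_in_filt: "length xs < n \<Longrightarrow> uea_word xs \<in> uea_filt n"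
  unfolding uea_filt_def by (rule complex_vector.span_base) blast

lemma uea2_word_in_filt: "length xs + length ys < n \<Longrightarrow> uea_word xs \<otimes> uea_word ys \<in> uea2_filt n"
  unfolding uea2_filt_def by (rule complex_vector.span_base) blast

lemmas filt_closed = complex_vector.span_zero complex_vector.span_add complex_vector.span_diff
  complex_vector.span_scale

lemma uea_filt_closed:
  "0 \<in> uea_filt n" "u \<in> uea_filt n \<Longrightarrow> v \<in> uea_filt n \<Longrightarrow> u + v \<in> uea_filt n"
  "u \<in> uea_filt n \<Longrightarrow> v \<in> uea_filt n \<Longrightarrow> u - v \<in> uea_filt n"
  "u \<in> uea_filt n \<Longrightarrow> c *\<^sub>C u \<in> uea_filt n"
  by (simp_all add: uea_filt_def filt_closed)

lemma uea2_filt_closed: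
  "0 \<in> uea2_filt n" "u \<in> uea2_filt n \<Longrightarrow> v \<in> uea2_filt n \<Longrightarrow> u + v \<in> uea2_filt n"
  "u \<in> uea2_filt n \<Longrightarrow> v \<in> uea2_filt n \<Longrightarrow> u - v \<in> uea2_filt n"
  "u \<in> uea2_filt n \<Longrightarrow> c *\<^sub>C u \<in> uea2_filt n"
  by (simp_all add: uea2_filt_def filt_closed)

lemma uea_filt_map:
  assumes "clinear F" "\<And>xs. length xs < n \<Longrightarrow> F (uea_word xs) \<in> uea_filt m" "u \<in> uea_filt n"
  shows "F u \<in> uea_filt m"
  using clinear_into_span[OF assms(1), of "{uea_word xs | xs. length xs < n}"] assms(2,3)
  unfolding uea_filt_def by blast

lemma uea2_filt_map:
  assumes "clinear F" "\<And>xs ys. length xs + length ys < n \<Longrightarrow> F (uea_word xs \<otimes> uea_word ys) \<in> uea2_filt m"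
    "t \<in> uea2_filt n"
  shows "F t \<in> uea2_filt m"
  using clinear_into_span[OF assms(1), of "{uea_word xs \<otimes> uea_word ys | xs ys. length xs + length ys < n}"]
    assms(2,3)
  unfolding uea2_filt_def by blast

lemma uea_filt_mono: "u \<in> uea_filt m \<Longrightarrow> m \<le> n \<Longrightarrow> u \<in> uea_filt n"
  by (rule uea_filt_map[OF clinear_ident]) (auto intro: uea_word_in_filt)

lemma uea2_filt_mono: "t \<in> uea2_filt m \<Longrightarrow> m \<le> n \<Longrightarrow> t \<in> uea2_filt n"
  by (rule uea2_filt_map[OF clinear_ident]) (auto intro: uea2_word_in_filt)

lemma uea_filt_mult_word:
  assumes "u \<in> uea_filt m"
  shows "uea_word xs * u \<in> uea_filt (length xs + m)" "u * uea_word xs \<in> uea_filt (length xs + m)"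
  by (rule uea_filt_map[OF clinear_mult_left _ assms],
      simp only: uea_word_simps(3)[symmetric], rule uea_word_in_filt, simp)
    (rule uea_filt_map[OF clinear_mult_right _ assms],
      simp only: uea_word_simps(3)[symmetric], rule uea_word_in_filt, simp)

lemma uea_filt_mult_inj: "u \<in> uea_filt m \<Longrightarrow> uea_inj x * u \<in> uea_filt (Suc m)"
  using uea_filt_mult_word(1)[of u m "[x]"] by simp

lemma uea_filt_exhausts: "\<exists>n. u \<in> uea_filt n"
  using span_uea_word[of u]
proof (induction rule: complex_vector.span_induct_alt)
  case base
  show ?case using uea_filt_closed(1) by blast
next
  case (step c x y)
  then obtain n xs where y: "y \<in> uea_filt n" and x: "x = uea_word xs" by blast
  have "x \<in> uea_filt (Suc (length xs) + n)" "y \<in> uea_filt (Suc (length xs) + n)"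
    using uea_word_in_filt[of xs] uea_filt_mono[OF y] by (simp_all add: x)
  then show ?case by (blast intro: uea_filt_closed)
qed

text \<open>Degrees add: with the strict bounds, \<open>m - 1\<close> and \<open>n - 1\<close> add up to at most \<open>k - 1\<close>.\<close>

lemma tensor_in_filt:
  assumes u: "u \<in> uea_filt m" and v: "v \<in> uea_filt n" and k: "m + n \<le> Suc k"
  shows "u \<otimes> v \<in> uea2_filt k"
proof -
  have "clinear F \<Longrightarrow> (\<And>xs. length xs < n \<Longrightarrow> F (uea_word xs) \<in> uea2_filt k)
      \<Longrightarrow> u \<in> uea_filt n \<Longrightarrow> F u \<in> uea2_filt k" for F n and u :: "'a uea"
    using clinear_into_span[of F "{uea_word xs | xs. length xs < n}"]
    unfolding uea_filt_def uea2_filt_def by blast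
  note map = this
  have "u \<otimes> uea_word ys \<in> uea2_filt k" if "length ys < n" for ys
    by (rule map[OF clinear_tensor_left _ u], rule uea2_word_in_filt) (use that k in linarith)
  then show ?thesis
    by (rule map[OF clinear_tensor_right _ v])
qed

lemma uea2_filt_exhausts: "\<exists>n. t \<in> uea2_filt n"
proof (induction t rule: tensor_induct)
  case zero
  show ?case using uea2_filt_closed(1) by blast
next
  case (tensor a b)
  obtain m n where "a \<in> uea_filt m" "b \<in> uea_filt n"
    using uea_filt_exhausts by blast
  then have "a \<otimes> b \<in> uea2_filt (m + n)" by (rule tensor_in_filt) simp
  then show ?case by blast
next
  case (add s t)
  then obtain m n where "s \<in> uea2_filt m" "t \<in> uea2_filt n" by blast
  then have "s + t \<in> uea2_filt (m + n)"
    by (auto intro!: uea2_filt_closed(2) elim: uea2_filt_mono)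
  then show ?case by blast
qed

lemma uea_coproduct_filt: "uea_coproduct (uea_word xs) \<in> uea2_filt (Suc (length xs))"
proof (induction xs)
  case Nil
  show ?case using uea2_word_in_filt[of "[] :: 'a list" "[] :: 'a list"] by (simp add: uea_coproduct_one one_tensor_def)
next
  case (Cons x xs)
  have "(uea_inj x \<otimes> 1) * uea_coproduct (uea_word xs) \<in> uea2_filt (Suc (length (x # xs)))"
    by (rule uea2_filt_map[OF clinear_mult_left _ Cons])
      (use uea2_word_in_filt[of "x # _"] in \<open>auto simp: tensor_mult_tensor\<close>)
  moreover have "(1 \<otimes> uea_inj x) * uea_coproduct (uea_word xs) \<in> uea2_filt (Suc (length (x # xs)))"
    by (rule uea2_filt_map[OF clinear_mult_left _ Cons])
      (use uea2_word_in_filt[of _ "x # _"] in \<open>auto simp: tensor_mult_tensor\<close>)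
  ultimately show ?case
    by (simp add: uea_coproduct_mult uea_coproduct_inj distrib_right uea2_filt_closed(2))
qed

lemma uea_word_commutator: "uea_word xs * uea_inj x - uea_inj x * uea_word xs \<in> uea_filt (Suc (length xs))"
proof (induction xs)
  case Nil
  show ?case by (simp add: uea_filt_closed(1))
next
  case (Cons y ys)
  have "uea_word (y # ys) * uea_inj x - uea_inj x * uea_word (y # ys)
    = uea_inj y * (uea_word ys * uea_inj x - uea_inj x * uea_word ys) + uea_word (lie y x # ys)"
    by (simp add: uea_inj_lie algebra_simps)
  moreover have "uea_word (lie y x # ys) \<in> uea_filt (Suc (length (y # ys)))"
    by (rule uea_word_in_filt) simp
  ultimately show ?case
    using uea_filt_closed(2)[OF uea_filt_mult_inj[OF Cons]] by simp
qed

text \<open>Coproduct and multiplication turn a word of length \<open>n\<close> into the sum over its \<open>2\<^sup>n\<close>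
  splittings into two complementary subwords, each of which is the original word up to commutators.
  By induction: a new first letter \<open>x\<close> is inserted in front of the first or of the second factor of the
  coproduct, and moving it across the first factor costs a commutator, which has lower degree.\<close>

lemma adams_word: "adams (uea_word xs) - 2 ^ length xs *\<^sub>C uea_word xs \<in> uea_filt (length xs)"
proof (induction xs)
  case Nil
  show ?case
    by (simp add: adams_def convolution_one clinear_ident scaleC_one uea_filt_closed(1))
next
  case (Cons x xs)
  let ?w = "uea_word xs" and ?x = "uea_inj x"
  \<comment> \<open>On \<open>u \<otimes> v\<close> this is \<open>[u, x] v\<close>, the cost of moving \<open>x\<close> to the front.\<close>
  let ?h = "\<lambda>t. mult_lift (\<lambda>u. u) (\<lambda>v. ?x * v) t - ?x * uea_mult t"
  have h: "clinear ?h"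
    by (rule clinear_minus_fun[OF clinear_mult_lift[OF clinear_ident clinear_mult_left]
          clinear_compose[OF clinear_uea_mult clinear_mult_left]])
  have "?h t \<in> uea_filt n" if "t \<in> uea2_filt n" for t n
  proof -
    have "?h (uea_word ys \<otimes> uea_word zs) \<in> uea_filt n" if "length ys + length zs < n" for ys zs
    proof -
      have "?h (uea_word ys \<otimes> uea_word zs) = (uea_word ys * ?x - ?x * uea_word ys) * uea_word zs"
        by (simp add: mult_lift_tensor clinear_ident clinear_mult_left algebra_simps)
      with uea_filt_mult_word(2)[OF uea_word_commutator, of ys x zs] that show ?thesis
        by (simp add: uea_filt_mono)
    qed
    then show ?thesis
      using clinear_into_span[OF h, of "{uea_word xs \<otimes> uea_word ys | xs ys. length xs + length ys < n}"] that
      unfolding uea_filt_def uea2_filt_def by blast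
  qed
  from this[OF uea_coproduct_filt[of xs]] have 1: "?h (uea_coproduct ?w) \<in> uea_filt (length (x # xs))"
    by simp
  have "uea_mult ((?x \<otimes> 1) * t) = ?x * uea_mult t" for t
    by (rule tensor_lift_unique[OF clinear_compose[OF clinear_mult_left clinear_uea_mult]
          clinear_compose[OF clinear_uea_mult clinear_mult_left]])
      (simp add: tensor_mult_tensor uea_mult_tensor mult.assoc)
  moreover have "uea_mult ((1 \<otimes> ?x) * t) = mult_lift (\<lambda>u. u) (\<lambda>v. ?x * v) t" for t
    by (rule tensor_lift_unique[OF clinear_compose[OF clinear_mult_left clinear_uea_mult]
          clinear_mult_lift[OF clinear_ident clinear_mult_left]])
      (simp add: tensor_mult_tensor uea_mult_tensor mult_lift_tensor clinear_ident clinear_mult_left)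
  ultimately have "adams (?x * ?w) = ?h (uea_coproduct ?w) + (?x * adams ?w + ?x * adams ?w)"
    by (simp add: adams_def convolution_def uea_coproduct_mult uea_coproduct_inj distrib_right
        clinear_add[OF clinear_uea_mult])
  moreover have "?x * adams ?w + ?x * adams ?w = 2 *\<^sub>C (?x * adams ?w)"
    using scaleC_add_left[of 1 1 "?x * adams ?w"] by (simp add: scaleC_one)
  ultimately have "adams (uea_word (x # xs)) - 2 ^ length (x # xs) *\<^sub>C uea_word (x # xs)
      = ?h (uea_coproduct ?w) + 2 *\<^sub>C (?x * (adams ?w - 2 ^ length xs *\<^sub>C ?w))"
    by (simp add: right_diff_distrib mult_scaleC_right scaleC_scaleC
        complex_vector.scale_right_diff_distrib)
  moreover have "?x * (adams ?w - 2 ^ length xs *\<^sub>C ?w) \<in> uea_filt (length (x # xs))"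
    using uea_filt_mult_inj[OF Cons] by simp
  ultimately show ?case
    using 1 by (simp only: uea_filt_closed)
qed

lemma adams_tensor_filt:
  assumes "t \<in> uea2_filt (Suc n)"
  shows "tensor_map adams adams t - 2 ^ n *\<^sub>C t \<in> uea2_filt n"
proof (rule uea2_filt_map[OF _ _ assms])
  show "clinear (\<lambda>t. tensor_map adams adams t - 2 ^ n *\<^sub>C t)"
    by (rule clinear_minus_fun[OF clinear_tensor_map[OF clinear_adams clinear_adams]
          clinear_scale_fun[OF clinear_ident]])
  fix xs ys :: "'a list"
  let ?u = "uea_word xs" and ?v = "uea_word ys" and ?i = "length xs" and ?j = "length ys"
  assume len: "?i + ?j < Suc n"
  have v: "adams ?v \<in> uea_filt (Suc ?j)"
    using uea_filt_closed(2)[OF uea_filt_mono[OF adams_word, of ys "Suc ?j"]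
        uea_filt_closed(4)[OF uea_word_in_filt[of ys "Suc ?j"], of "2 ^ ?j"]]
    by simp
  have "tensor_map adams adams (?u \<otimes> ?v) - 2 ^ (?i + ?j) *\<^sub>C (?u \<otimes> ?v)
    = (adams ?u - 2 ^ ?i *\<^sub>C ?u) \<otimes> adams ?v + 2 ^ ?i *\<^sub>C (?u \<otimes> (adams ?v - 2 ^ ?j *\<^sub>C ?v))"
    by (simp add: tensor_map_tensor clinear_adams tensor_diff_left tensor_diff_right tensor_scaleC_left
        tensor_scaleC_right complex_vector.scale_right_diff_distrib scaleC_scaleC power_add)
  moreover have "(adams ?u - 2 ^ ?i *\<^sub>C ?u) \<otimes> adams ?v \<in> uea2_filt n"
    by (rule tensor_in_filt[OF adams_word v]) (use len in linarith)
  moreover have "?u \<otimes> (adams ?v - 2 ^ ?j *\<^sub>C ?v) \<in> uea2_filt n"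
    by (rule tensor_in_filt[OF uea_word_in_filt[OF lessI] adams_word]) (use len in linarith)
  ultimately have "tensor_map adams adams (?u \<otimes> ?v) - 2 ^ (?i + ?j) *\<^sub>C (?u \<otimes> ?v) \<in> uea2_filt n"
    by (simp only: uea2_filt_closed)
  moreover have "(2 ^ (?i + ?j) - 2 ^ n) *\<^sub>C (?u \<otimes> ?v) \<in> uea2_filt n"
  proof (cases "?i + ?j = n")
    case True
    then show ?thesis by (simp add: uea2_filt_closed(1))
  next
    case False
    with len show ?thesis
      by (intro uea2_filt_closed(4) uea2_word_in_filt) linarith
  qed
  ultimately have "(tensor_map adams adams (?u \<otimes> ?v) - 2 ^ (?i + ?j) *\<^sub>C (?u \<otimes> ?v))
      + (2 ^ (?i + ?j) - 2 ^ n) *\<^sub>C (?u \<otimes> ?v) \<in> uea2_filt n"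
    by (rule uea2_filt_closed(2))
  then show "tensor_map adams adams (?u \<otimes> ?v) - 2 ^ n *\<^sub>C (?u \<otimes> ?v) \<in> uea2_filt n"
    by (simp add: complex_vector.scale_left_diff_distrib)
qed


section \<open>Vanishing of symmetric invariant cohomology\<close>

definition central :: "'a::ring_1 \<Rightarrow> bool"
  where "central c \<longleftrightarrow> (\<forall>a. c * a = a * c)"

lemma centralD: "central c \<Longrightarrow> c * a = a * c"
  by (simp add: central_def)

definition uea_coboundary :: "'g::complex_lie_algebra uea \<Rightarrow> 'g uea \<otimes> 'g uea"
  where "uea_coboundary x = x \<otimes> 1 + 1 \<otimes> x - uea_coproduct x"

lemma clinear_uea_coboundary: "clinear uea_coboundary"
  unfolding uea_coboundary_def[abs_def]
  by (intro clinear_minus_fun clinear_plus clinear_tensor_left clinear_tensor_right clinear_uea_coproduct)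

lemma uea_cocycle_diff:
  assumes "uea_cocycle s" "uea_cocycle t"
  shows "uea_cocycle (s - t)"
  using assms unfolding uea_cocycle_def
  by (simp add: tensor_diff_left tensor_diff_right clinear_diff[OF clinear_tensor_assoc]
      clinear_diff[OF clinear_tensor_map[OF clinear_uea_coproduct clinear_ident]]
      clinear_diff[OF clinear_tensor_map[OF clinear_ident clinear_uea_coproduct]] algebra_simps)

lemma uea_cocycle_coboundary: "uea_cocycle (uea_coboundary x)"
proof -
  note l = clinear_tensor_map[OF clinear_uea_coproduct clinear_ident]
    clinear_tensor_map[OF clinear_ident clinear_uea_coproduct]
  note t = tensor_map_tensor[OF clinear_uea_coproduct clinear_ident]
    tensor_map_tensor[OF clinear_ident clinear_uea_coproduct]
  show ?thesis
    unfolding uea_cocycle_def uea_coboundary_def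
    by (simp add: l[THEN clinear_add] l[THEN clinear_diff] t uea_coproduct_one one_tensor_def
        tensor_add_left tensor_add_right tensor_diff_left tensor_diff_right tensor_assoc_tensor
        clinear_add[OF clinear_tensor_assoc] clinear_diff[OF clinear_tensor_assoc]
        uea_coproduct_coassociative)
qed

lemma tensor_flip_coboundary: "tensor_flip (uea_coboundary x) = uea_coboundary x"
  by (simp add: uea_coboundary_def clinear_add[OF clinear_tensor_flip]
      clinear_diff[OF clinear_tensor_flip] tensor_flip_tensor uea_coproduct_cocommutative)

lemma central_tensor:
  fixes a :: "'a::complex_algebra_1" and b :: "'b::complex_algebra_1"
  assumes "central a" "central b"
  shows "central (a \<otimes> b)"
proof -
  have "(a \<otimes> b) * t = t * (a \<otimes> b)" for t
    by (induction t rule: tensor_induct)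
      (simp_all add: distrib_left distrib_right tensor_mult_tensor centralD assms)
  then show ?thesis by (simp add: central_def)
qed

lemma uea_coboundary_invariant:
  assumes "central x"
  shows "uea_coboundary x * uea_coproduct a = uea_coproduct a * uea_coboundary x"
proof -
  have one: "central (1 :: 'a uea)" by (simp add: central_def)
  show ?thesis
    using centralD[OF central_tensor[OF assms one]] centralD[OF central_tensor[OF one assms]]
      centralD[OF assms, of a]
    by (simp add: uea_coboundary_def left_diff_distrib right_diff_distrib distrib_left distrib_right
        flip: uea_coproduct_mult)
qed

lemma central_ueaI:
  assumes "\<And>x. uea_inj x * u = u * uea_inj x"
  shows "central u"
proof -
  have "u * uea_word xs - uea_word xs * u = 0" for xs
  proof (induction xs)
    case (Cons x xs)
    have "u * (uea_inj x * uea_word xs) = uea_inj x * (u * uea_word xs)"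
      by (simp only: mult.assoc[symmetric] assms)
    with Cons show ?case by (simp add: mult.assoc)
  qed simp
  then have "u * a - a * u = 0" for a
    using clinear_zero_on_span[OF clinear_minus_fun[OF clinear_mult_left clinear_mult_right] _
        span_uea_word] by blast
  then show ?thesis by (simp add: central_def)
qed

text \<open>For \<open>x \<in> \<gg>\<close>, multiplication intertwines the commutator with \<open>x \<otimes> 1 + 1 \<otimes> x\<close> with the
  commutator with \<open>x\<close>.\<close>

lemma central_uea_mult:
  assumes "\<And>a. e * uea_coproduct a = uea_coproduct a * e"
  shows "central (uea_mult e)"
proof (rule central_ueaI)
  fix x :: 'a
  let ?d = "\<lambda>t. uea_coproduct (uea_inj x) * t - t * uea_coproduct (uea_inj x)"
  have "uea_mult (?d e) = uea_inj x * uea_mult e - uea_mult e * uea_inj x"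
  proof (rule tensor_lift_unique[where F = "\<lambda>t. uea_mult (?d t)"])
    show "clinear (\<lambda>t. uea_mult (?d t))"
      by (rule clinear_compose[OF clinear_minus_fun[OF clinear_mult_left clinear_mult_right] clinear_uea_mult])
    show "clinear (\<lambda>t. uea_inj x * uea_mult t - uea_mult t * uea_inj x)"
      by (rule clinear_minus_fun[OF clinear_compose[OF clinear_uea_mult clinear_mult_left]
            clinear_compose[OF clinear_uea_mult clinear_mult_right]])
  qed (simp add: uea_coproduct_inj distrib_left distrib_right tensor_mult_tensor
      clinear_add[OF clinear_uea_mult] clinear_diff[OF clinear_uea_mult] uea_mult_tensor algebra_simps)
  then show "uea_inj x * uea_mult e = uea_mult e * uea_inj x"
    by (simp add: assms clinear_0[OF clinear_uea_mult])
qed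

text \<open>The counit followed by the unit, which is the neutral element for convolution.\<close>

definition uea_aug :: "'g::complex_lie_algebra uea \<Rightarrow> 'g uea"
  where "uea_aug u = uea_counit u *\<^sub>C 1"

lemma algebra_hom_scalar: "algebra_hom (\<lambda>c. c *\<^sub>C (1::'a::complex_algebra_1))"
  by (auto simp: algebra_hom_def scaleC_one scaleC_add_left scaleC_scaleC scaleC_complex_def
      mult_scaleC_left mult_scaleC_right mult.commute intro!: clinearI)

lemma algebra_hom_uea_aug: "algebra_hom uea_aug"
  unfolding uea_aug_def[abs_def]
  by (rule algebra_hom_compose[OF algebra_hom_uea_counit algebra_hom_scalar])

lemma uea_aug_simps: "clinear uea_aug" "uea_aug 1 = 1" "uea_aug (uea_inj x) = 0"
  using algebra_hom_uea_aug by (auto simp: algebra_hom_def uea_aug_def uea_counit_inj complex_vector.scale_zero_left)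

lemma uea_aug_commute: "uea_aug a * b = b * uea_aug a"
  by (simp add: uea_aug_def mult_scaleC_left mult_scaleC_right)

lemma algebra_hom_mult_lift:
  assumes "algebra_hom f" "algebra_hom g" "\<And>a b. f a * g b = g b * f a"
  shows "algebra_hom (mult_lift f g)"
proof -
  have fg: "clinear f" "f 1 = 1" "\<And>a b. f (a * b) = f a * f b"
    "clinear g" "g 1 = 1" "\<And>a b. g (a * b) = g a * g b"
    using assms(1,2) by (auto simp: algebra_hom_def)
  have "f a * (f a' * (g b * g b')) = f a * (g b * (f a' * g b'))" for a a' b b'
    by (simp only: mult.assoc[symmetric] assms(3)[of a' b])
  then show ?thesis
    by (intro algebra_hom_tensorI clinear_mult_lift fg) (simp_all add: mult_lift_tensor fg mult.assoc)
qed

lemma convolution_aug: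
  "convolution (\<lambda>x. x) uea_aug = (\<lambda>x :: 'a::complex_lie_algebra uea. x)"
  "convolution uea_aug (\<lambda>x. x) = (\<lambda>x :: 'a uea. x)"
  "convolution uea_aug uea_aug = (uea_aug :: 'a uea \<Rightarrow> 'a uea)"
proof -
  note A = uea_aug_simps clinear_ident
  have *: "convolution f g u = k u" if "algebra_hom f" "algebra_hom g" "algebra_hom k"
    "\<And>a b. f a * g b = g b * f a" "\<And>x. f (uea_inj x) + g (uea_inj x) = k (uea_inj x)"
    for f g k :: "'a uea \<Rightarrow> 'a uea" and u
    unfolding convolution_def
    by (rule algebra_hom_uea_eqI[OF algebra_hom_compose[OF algebra_hom_uea_coproduct
            algebra_hom_mult_lift[OF that(1,2,4)]] that(3)])
      (use that in \<open>simp add: uea_coproduct_inj algebra_hom_def mult_lift_tensor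
        clinear_add[OF clinear_mult_lift]\<close>)
  show "convolution (\<lambda>x. x) uea_aug = (\<lambda>x::'a uea. x)" "convolution uea_aug (\<lambda>x. x) = (\<lambda>x::'a uea. x)"
    "convolution uea_aug uea_aug = (uea_aug :: 'a uea \<Rightarrow> _)"
    by (rule ext, rule *, rule algebra_hom_ident algebra_hom_uea_aug, rule algebra_hom_ident algebra_hom_uea_aug,
        rule algebra_hom_ident algebra_hom_uea_aug, rule uea_aug_commute uea_aug_commute[symmetric],
        simp add: uea_aug_simps)+
qed

text \<open>The cocycle identity at the neutral point gives \<open>e(1, 1) = e(a, 1) = e(1, a)\<close>, and an element of
  degree at most 1 satisfies \<open>e(a, b) = e(a, 1) + e(1, b) - e(1, 1)\<close>.\<close>

lemma cocycle_degree_one: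
  assumes e: "uea_cocycle e" and filt: "e \<in> uea2_filt 2"
  shows "\<exists>c. e = c *\<^sub>C 1"
proof -
  note id = clinear_ident and ad = uea_aug_simps(1)
  let ?f = "mult_lift (\<lambda>x. x) uea_aug" and ?g = "mult_lift uea_aug (\<lambda>x. x)"
    and ?h = "mult_lift uea_aug uea_aug"
  have f: "clinear ?f" and g: "clinear ?g" and h: "clinear ?h"
    by (intro clinear_mult_lift id ad)+
  let ?H = "\<lambda>t. ?f t \<otimes> 1 + 1 \<otimes> ?g t - ?h t \<otimes> 1 - t"
  have lin: "clinear ?H"
    by (intro clinear_minus_fun clinear_plus clinear_compose[OF f clinear_tensor_left]
        clinear_compose[OF g clinear_tensor_right] clinear_compose[OF h clinear_tensor_left] id)
  have "?H (uea_word xs \<otimes> uea_word ys) = 0" if len: "length xs + length ys < 2" for xs ys :: "'a list"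
  proof -
    consider "xs = []" "ys = []" | x where "xs = [x]" "ys = []" | y where "xs = []" "ys = [y]"
      using len that by (cases xs; cases ys) auto
    then show ?thesis
      by cases (simp_all add: mult_lift_tensor id uea_aug_simps tensor_0_left tensor_0_right)
  qed
  then have "?H e = 0"
    using clinear_zero_on_span[OF lin, of "{uea_word xs \<otimes> uea_word ys | xs ys. length xs + length ys < 2}"] filt
    unfolding uea2_filt_def by blast
  moreover have "?f e = ?h e"
    using cocycle_convolution[OF e, of "\<lambda>x. x" uea_aug uea_aug] by (simp add: id uea_aug_simps convolution_aug)
  moreover have "?g e = ?h e"
    using cocycle_convolution[OF e, of uea_aug uea_aug "\<lambda>x. x"] by (simp add: id uea_aug_simps convolution_aug)
  moreover have "?h e = mult_lift uea_counit uea_counit e *\<^sub>C 1"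
  proof -
    have c: "clinear (uea_counit :: 'a uea \<Rightarrow> _)"
      using algebra_hom_uea_counit[where 'g = 'a] by (simp add: algebra_hom_def)
    show ?thesis
      using mult_lift_compose_hom[OF algebra_hom_scalar[where 'a = "'a uea"] c c, of e]
      by (simp add: uea_aug_def[abs_def])
  qed
  ultimately have "e = mult_lift uea_counit uea_counit e *\<^sub>C 1"
    by (simp add: tensor_scaleC_left tensor_scaleC_right one_tensor_def)
  then show ?thesis by blast
qed

text \<open>Induction on the degree of \<open>e\<close>.  Subtracting the coboundary of the central element
  \<open>\<mu>(e) / (2 - 2\<^sup>m)\<close> leaves a symmetric invariant cocycle equal to
  \<open>((\<psi> \<otimes> \<psi>) e - 2\<^sup>m e) / (2 - 2\<^sup>m)\<close>, which has lower degree.\<close>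

theorem symmetric_invariant_cocycle_is_coboundary:
  assumes "uea_cocycle e" "tensor_flip e = e" "\<And>a. e * uea_coproduct a = uea_coproduct a * e"
  shows "\<exists>x. central x \<and> e = uea_coboundary x"
proof -
  have "\<exists>x. central x \<and> e = uea_coboundary x"
    if "e \<in> uea2_filt (Suc (Suc n))" "uea_cocycle e" "tensor_flip e = e"
      "\<And>a. e * uea_coproduct a = uea_coproduct a * e" for n and e :: "'a uea \<otimes> 'a uea"
    using that
  proof (induction n arbitrary: e)
    case 0
    then obtain c where "e = c *\<^sub>C 1"
      using cocycle_degree_one[of e] by (auto simp: numeral_2_eq_2)
    moreover have "uea_coboundary (1 :: 'a uea) = 1"
      by (simp add: uea_coboundary_def uea_coproduct_one flip: one_tensor_def)
    ultimately have "e = uea_coboundary (c *\<^sub>C 1)"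
      by (simp add: clinear_scaleC[OF clinear_uea_coboundary])
    moreover have "central (c *\<^sub>C (1 :: 'a uea))"
      by (simp add: central_def mult_scaleC_left mult_scaleC_right)
    ultimately show ?case by blast
  next
    case (Suc n)
    let ?m = "Suc (Suc n)"
    \<comment> \<open>In degree \<open>m \<ge> 2\<close>, \<open>\<psi> \<otimes> \<psi>\<close> is \<open>2\<^sup>m\<close> to leading order, so the
      factor \<open>2 - 2\<^sup>m\<close> can be divided out of the identity for \<open>2 e - (\<psi> \<otimes> \<psi>) e\<close>.\<close>
    define k :: complex where "k = 2 - 2 ^ ?m"
    have "(2::nat) ^ ?m \<noteq> 2 ^ 1"
      by (subst power_inject_exp) auto
    then have "(2::complex) ^ ?m \<noteq> 2"
      by (metis of_nat_eq_iff of_nat_numeral of_nat_power power_one_right)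
    then have k: "k \<noteq> 0" by (simp add: k_def)
    define x where "x = (1 / k) *\<^sub>C uea_mult e"
    have x: "central x"
      using central_uea_mult[OF Suc.prems(4)]
      by (simp add: x_def central_def mult_scaleC_left mult_scaleC_right)
    have "k *\<^sub>C (e - uea_coboundary x) = tensor_map adams adams e - 2 ^ ?m *\<^sub>C e"
    proof -
      have "k *\<^sub>C uea_coboundary x = 2 *\<^sub>C e - tensor_map adams adams e"
        using cocycle_adams[OF Suc.prems(2,3), folded uea_coboundary_def] k
        by (simp add: x_def clinear_scaleC[OF clinear_uea_coboundary] scaleC_scaleC scaleC_one)
      then show ?thesis
        by (simp add: k_def complex_vector.scale_right_diff_distrib complex_vector.scale_left_diff_distrib)
    qed
    then have "(1 / k) *\<^sub>C (k *\<^sub>C (e - uea_coboundary x)) \<in> uea2_filt ?m"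
      using adams_tensor_filt[OF Suc.prems(1)] by (simp only: uea2_filt_closed)
    then have "e - uea_coboundary x \<in> uea2_filt ?m"
      using k by (simp add: scaleC_scaleC scaleC_one)
    then have "\<exists>y. central y \<and> e - uea_coboundary x = uea_coboundary y"
    proof (rule Suc.IH)
      show "uea_cocycle (e - uea_coboundary x)"
        by (rule uea_cocycle_diff[OF Suc.prems(2) uea_cocycle_coboundary])
      show "tensor_flip (e - uea_coboundary x) = e - uea_coboundary x"
        by (simp add: clinear_diff[OF clinear_tensor_flip] Suc.prems(3) tensor_flip_coboundary)
      show "(e - uea_coboundary x) * uea_coproduct a = uea_coproduct a * (e - uea_coboundary x)" for a
        by (simp add: left_diff_distrib right_diff_distrib Suc.prems(4) uea_coboundary_invariant[OF x])
    qed
    then obtain y where y: "central y" "e - uea_coboundary x = uea_coboundary y" by blast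
    then have "e = uea_coboundary (x + y)"
      by (simp add: clinear_add[OF clinear_uea_coboundary] algebra_simps)
    moreover have "central (x + y)"
      using x y(1) by (simp add: central_def distrib_left distrib_right)
    ultimately show ?case by blast
  qed
  moreover obtain n where "e \<in> uea2_filt n"
    using uea2_filt_exhausts[of e] by blast
  then have "e \<in> uea2_filt (Suc (Suc n))"
    by (rule uea2_filt_mono) simp
  ultimately show ?thesis
    using assms by blast
qed


section \<open>Linear maps of formal power series\<close>

lemma h_linear_ident: "h_linear (\<lambda>v. v)"
  by (simp add: h_linear_def)

lemma h_linear_compose: "h_linear F \<Longrightarrow> h_linear G \<Longrightarrow> h_linear (\<lambda>v. G (F v))"
  by (simp add: h_linear_def)

lemma fps_scale_mult_left: "(c *\<^sub>h u) * v = c *\<^sub>h (u * v)"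
  for u v :: "'a::complex_algebra_1 fps"
proof (rule fps_ext)
  fix n
  show "((c *\<^sub>h u) * v) $ n = (c *\<^sub>h (u * v)) $ n"
    using fps_mult_assoc_lemma[where k = n and n = n and f = "\<lambda>i j k. c $ i *\<^sub>C (u $ j * v $ k)"]
    by (simp add: fps_scale_def fps_mult_nth sum_distrib_right mult_scaleC_left
        complex_vector.scale_sum_right)
qed

lemma fps_scale_mult_right: "u * (c *\<^sub>h v) = c *\<^sub>h (u * v)"
  for u v :: "'a::complex_algebra_1 fps"
proof (rule fps_ext)
  fix n
  have "(u * (c *\<^sub>h v)) $ n = (\<Sum>i=0..n. \<Sum>j=0..n-i. c $ j *\<^sub>C (u $ i * v $ (n - i - j)))"
    by (simp add: fps_scale_def fps_mult_nth sum_distrib_left mult_scaleC_right)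
  also have "\<dots> = (\<Sum>i=0..n. \<Sum>j=0..i. c $ (i - j) *\<^sub>C (u $ j * v $ (n - i)))"
    using fps_mult_assoc_lemma[where k = n and n = n and f = "\<lambda>i j k. c $ j *\<^sub>C (u $ i * v $ k)"]
    by simp
  also have "\<dots> = (\<Sum>i=0..n. \<Sum>j=0..i. c $ j *\<^sub>C (u $ (i - j) * v $ (n - i)))"
    by (rule sum.cong[OF refl], subst sum.atLeastAtMost_rev) (auto intro!: sum.cong)
  also have "\<dots> = (\<Sum>i=0..n. \<Sum>j=0..n-i. c $ i *\<^sub>C (u $ j * v $ (n - i - j)))"
    by (rule fps_mult_assoc_lemma[where k = n and n = n and f = "\<lambda>i j k. c $ i *\<^sub>C (u $ j * v $ k)"])
  also have "\<dots> = (c *\<^sub>h (u * v)) $ n"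
    by (simp add: fps_scale_def fps_mult_nth complex_vector.scale_sum_right)
  finally show "(u * (c *\<^sub>h v)) $ n = (c *\<^sub>h (u * v)) $ n" .
qed

lemma h_linear_mult_left: "h_linear (\<lambda>v. u * v)"
  and h_linear_mult_right: "h_linear (\<lambda>v. v * u)"
  for u :: "'a::complex_algebra_1 fps"
  by (simp_all add: h_linear_def distrib_left distrib_right fps_scale_mult_left fps_scale_mult_right)

lemma h_linear_tensor_left: "h_linear (\<lambda>v. v \<otimes>\<^sub>h w)"
  and h_linear_tensor_right: "h_linear (\<lambda>w. v \<otimes>\<^sub>h w)"
  by (simp_all add: h_linear_def fps_tensor_add_left fps_tensor_add_right fps_tensor_scale_left
      fps_tensor_scale_right)

lemma h_linear_fps_apply: "clinear f \<Longrightarrow> h_linear (fps_apply f)"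
  by (simp add: h_linear_def fps_apply_scale) (simp add: fps_eq_iff fps_apply_def clinear_add)

lemma h_linear_eqI:
  assumes "h_linear F" "h_linear G" "\<And>x. F (fps_const x) = G (fps_const x)"
  shows "F v = G v"
proof (rule fps_ext)
  fix n
  show "F v $ n = G v $ n"
    using h_linear_nth[OF assms(1), of v n] h_linear_nth[OF assms(2), of v n] by (simp add: assms(3))
qed

lemma fps_tensor_const: "fps_const a \<otimes>\<^sub>h fps_const b = fps_const (a \<otimes> b)"
  by (rule fps_ext) (auto simp: fps_tensor_def tensor_0_left tensor_0_right intro!: sum.neutral)

text \<open>Maps linear over \<open>\<complex>[[h]]\<close> are determined by constant series, because
  \<open>h\<close>-linearity already implies \<open>h\<close>-adic continuity; identities between such maps therefore need to
  be checked on pure tensors only.\<close>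

lemma h_linear_tensor_eqI:
  assumes F: "h_linear F" and G: "h_linear G" and eq: "\<And>v w. F (v \<otimes>\<^sub>h w) = G (v \<otimes>\<^sub>h w)"
  shows "F t = G t"
proof (rule h_linear_eqI[OF F G])
  note l = h_linear_imp_clinear[OF F] h_linear_imp_clinear[OF G]
  show "F (fps_const t) = G (fps_const t)" for t
    by (induction t rule: tensor_induct)
      (simp_all add: clinear_0[OF l(1)] clinear_0[OF l(2)] h_linear_add[OF F] h_linear_add[OF G] eq
        fps_tensor_const[symmetric] fps_const_add[symmetric] del: fps_const_add)
qed

lemma fps_tensor_mult:
  fixes a c :: "'a::complex_algebra_1 fps" and b d :: "'b::complex_algebra_1 fps"
  shows "(a \<otimes>\<^sub>h b) * (c \<otimes>\<^sub>h d) = (a * c) \<otimes>\<^sub>h (b * d)"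
proof -
  note l = h_linear_compose[OF h_linear_tensor_left h_linear_mult_left]
    h_linear_compose[OF h_linear_tensor_right h_linear_mult_left]
    h_linear_compose[OF h_linear_tensor_left h_linear_mult_right]
    h_linear_compose[OF h_linear_tensor_right h_linear_mult_right]
  note r = h_linear_compose[OF h_linear_mult_left h_linear_tensor_left]
    h_linear_compose[OF h_linear_mult_left h_linear_tensor_right]
    h_linear_compose[OF h_linear_mult_right h_linear_tensor_left]
    h_linear_compose[OF h_linear_mult_right h_linear_tensor_right]
  have 1: "(fps_const a \<otimes>\<^sub>h fps_const b) * (fps_const c \<otimes>\<^sub>h d)
      = (fps_const a * fps_const c) \<otimes>\<^sub>h (fps_const b * d)"
    for a c :: 'a and b :: 'b and d
    by (rule h_linear_eqI[OF l(2) r(2)]) (simp add: fps_tensor_const tensor_mult_tensor)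
  have 2: "(fps_const a \<otimes>\<^sub>h fps_const b) * (c \<otimes>\<^sub>h d) = (fps_const a * c) \<otimes>\<^sub>h (fps_const b * d)"
    for a :: 'a and b :: 'b and c and d
    by (rule h_linear_eqI[OF l(1) r(1)]) (rule 1)
  have 3: "(fps_const a \<otimes>\<^sub>h b) * (c \<otimes>\<^sub>h d) = (fps_const a * c) \<otimes>\<^sub>h (b * d)"
    for a :: 'a and b d :: "'b fps" and c
    by (rule h_linear_eqI[OF l(4) r(4)]) (rule 2)
  show ?thesis
    by (rule h_linear_eqI[OF l(3) r(3)]) (rule 3)
qed

lemma fps_tensor_one:
  "(1 :: 'a::complex_algebra_1 fps) \<otimes>\<^sub>h (1 :: 'b::complex_algebra_1 fps) = 1"
  using fps_tensor_const[of "1 :: 'a" "1 :: 'b"] by (simp flip: one_tensor_def)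

lemma fps_tensor_nth_0: "(v \<otimes>\<^sub>h w) $ 0 = v $ 0 \<otimes> w $ 0"
  by (simp add: fps_tensor_def)

lemma fps_flip_tensor: "fps_apply tensor_flip (v \<otimes>\<^sub>h w) = w \<otimes>\<^sub>h v"
  by (rule fps_tensor_commute[symmetric])

lemma fps_assoc_tensor:
  fixes u :: "'a::complex_vector fps" and v :: "'b::complex_vector fps" and w :: "'c::complex_vector fps"
  shows "fps_apply tensor_assoc ((u \<otimes>\<^sub>h v) \<otimes>\<^sub>h w) = u \<otimes>\<^sub>h (v \<otimes>\<^sub>h w)"
proof -
  note A = h_linear_fps_apply[OF clinear_tensor_assoc]
  have 1: "fps_apply tensor_assoc ((fps_const a \<otimes>\<^sub>h fps_const b) \<otimes>\<^sub>h w)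
      = fps_const a \<otimes>\<^sub>h (fps_const b \<otimes>\<^sub>h w)" for a :: 'a and b :: 'b and w :: "'c fps"
  proof (rule h_linear_eqI[OF h_linear_compose[OF h_linear_tensor_right A]
        h_linear_compose[OF h_linear_tensor_right h_linear_tensor_right]])
    show "fps_apply tensor_assoc ((fps_const a \<otimes>\<^sub>h fps_const b) \<otimes>\<^sub>h fps_const c)
      = fps_const a \<otimes>\<^sub>h (fps_const b \<otimes>\<^sub>h fps_const c)" for c :: 'c
      unfolding fps_tensor_const
      by (rule fps_ext) (simp add: fps_apply_def tensor_assoc_tensor clinear_0[OF clinear_tensor_assoc])
  qed
  have 2: "fps_apply tensor_assoc ((fps_const a \<otimes>\<^sub>h v) \<otimes>\<^sub>h w)
      = fps_const a \<otimes>\<^sub>h (v \<otimes>\<^sub>h w)" for a :: 'a and v :: "'b fps" and w :: "'c fps"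
    by (rule h_linear_eqI[OF h_linear_compose[OF h_linear_compose[OF h_linear_tensor_right h_linear_tensor_left] A]
        h_linear_compose[OF h_linear_tensor_left h_linear_tensor_right]]) (rule 1)
  show ?thesis
    by (rule h_linear_eqI[OF h_linear_compose[OF h_linear_compose[OF h_linear_tensor_left h_linear_tensor_left] A]
        h_linear_tensor_left]) (rule 2)
qed

lemma
  assumes "h_algebra_hom F"
  shows h_algebra_hom_linear: "h_linear F"
    and h_algebra_hom_one: "F 1 = 1"
    and h_algebra_hom_mult: "F (a * b) = F a * F b"
  using assms by (auto simp: h_algebra_hom_def)

lemma h_algebra_hom_ident: "h_algebra_hom (\<lambda>v. v)"
  by (simp add: h_algebra_hom_def h_linear_ident)

lemma h_algebra_hom_fps_apply:
  assumes "algebra_hom f"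
  shows "h_algebra_hom (fps_apply f)"
proof -
  have f: "clinear f" "f 1 = 1" "\<And>a b. f (a * b) = f a * f b"
    using assms by (auto simp: algebra_hom_def)
  have "fps_apply f (a * b) = fps_apply f a * fps_apply f b" for a b
    by (rule fps_ext) (simp add: fps_apply_def fps_mult_nth clinear_sum[OF f(1)] f(3))
  moreover have "fps_apply f 1 = 1"
    by (rule fps_ext) (simp add: fps_apply_def clinear_0[OF f(1)] f(2))
  ultimately show ?thesis
    by (simp add: h_algebra_hom_def h_linear_fps_apply f(1))
qed

lemma h_algebra_hom_leg1: "h_algebra_hom (\<lambda>v::'a::complex_algebra_1 fps. v \<otimes>\<^sub>h (1::'b::complex_algebra_1 fps))"
  and h_algebra_hom_leg2: "h_algebra_hom (\<lambda>w::'b::complex_algebra_1 fps. (1::'a::complex_algebra_1 fps) \<otimes>\<^sub>h w)"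
  by (simp_all add: h_algebra_hom_def h_linear_tensor_left h_linear_tensor_right fps_tensor_one fps_tensor_mult)

lemma h_algebra_hom_fps_tensor_map:
  fixes F :: "'a::complex_algebra_1 fps \<Rightarrow> 'c::complex_algebra_1 fps"
    and G :: "'b::complex_algebra_1 fps \<Rightarrow> 'd::complex_algebra_1 fps"
  assumes "h_algebra_hom F" "h_algebra_hom G"
  shows "h_algebra_hom (fps_tensor_map F G)"
proof -
  let ?T = "fps_tensor_map F G"
  note F = h_algebra_hom_linear[OF assms(1)] and G = h_algebra_hom_linear[OF assms(2)]
  note T = h_linear_fps_tensor_map[OF F G]
  have 1: "?T ((v \<otimes>\<^sub>h w) * t) = ?T (v \<otimes>\<^sub>h w) * ?T t" for v w t
    by (rule h_linear_tensor_eqI[OF h_linear_compose[OF h_linear_mult_left T]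
          h_linear_compose[OF T h_linear_mult_left]])
      (simp add: fps_tensor_mult fps_tensor_map_tensor[OF F G] assms h_algebra_hom_mult)
  have "?T (s * t) = ?T s * ?T t" for s t
    by (rule h_linear_tensor_eqI[OF h_linear_compose[OF h_linear_mult_right T]
          h_linear_compose[OF T h_linear_mult_right]]) (rule 1)
  moreover have "?T 1 = 1"
    using fps_tensor_map_tensor[OF F G, of 1 1] assms
    by (simp add: fps_tensor_one h_algebra_hom_one)
  ultimately show ?thesis
    using T by (simp add: h_algebra_hom_def)
qed

lemma central_fps_tensor:
  fixes c :: "'a::complex_algebra_1 fps" and d :: "'b::complex_algebra_1 fps"
  assumes "central c" "central d"
  shows "central (c \<otimes>\<^sub>h d)"
proof -
  have "(c \<otimes>\<^sub>h d) * t = t * (c \<otimes>\<^sub>h d)" for t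
    by (rule h_linear_tensor_eqI[OF h_linear_mult_left h_linear_mult_right])
      (simp add: fps_tensor_mult centralD[OF assms(1)] centralD[OF assms(2)])
  then show ?thesis by (simp add: central_def)
qed

lemma central_one: "central 1"
  by (simp add: central_def)

lemma central_mult: "central c \<Longrightarrow> central d \<Longrightarrow> central (c * d)"
  unfolding central_def by (metis mult.assoc)

lemma central_inverse:
  fixes c :: "'a::ring_1 fps"
  assumes "central c" "c $ 0 = 1"
  obtains k where "central k" "k $ 0 = 1" "c * k = 1" "k * c = 1"
proof
  let ?k = "fps_right_inverse c 1"
  show ck: "c * ?k = 1"
    by (rule fps_right_inverse) (simp add: assms(2))
  then show kc: "?k * c = 1"
    using centralD[OF assms(1)] by simp
  show "?k $ 0 = 1" by simp
  have "?k * a = a * ?k" for a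
  proof -
    have "?k * a = ?k * a * (c * ?k)" by (simp add: ck)
    also have "\<dots> = ?k * (c * a) * ?k" by (simp add: centralD[OF assms(1)] mult.assoc)
    also have "\<dots> = a * ?k" by (simp add: mult.assoc[symmetric] kc)
    finally show ?thesis .
  qed
  then show "central ?k" by (simp add: central_def)
qed

section \<open>Truncation and leading coefficients\<close>

definition agree :: "nat \<Rightarrow> 'a fps \<Rightarrow> 'a fps \<Rightarrow> bool"
  where "agree n u v \<longleftrightarrow> (\<forall>m<n. u $ m = v $ m)"

lemma agree_h_linear:
  assumes "h_linear F" "agree n u v"
  shows "agree n (F u) (F v)"
  unfolding agree_def
proof (intro allI impI)
  fix m assume "m < n"
  then show "F u $ m = F v $ m"
    using assms(2) h_linear_nth[OF assms(1), of u m] h_linear_nth[OF assms(1), of v m]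
    by (simp add: agree_def)
qed

lemma agree_sym: "agree n u v \<Longrightarrow> agree n v u"
  by (simp add: agree_def)

lemma agree_trans: "agree n u v \<Longrightarrow> agree n v w \<Longrightarrow> agree n u w"
  by (simp add: agree_def)

lemma agree_mono: "agree n u v \<Longrightarrow> m \<le> n \<Longrightarrow> agree m u v"
  by (simp add: agree_def)

lemma agree_all: "(\<And>n. agree n u v) \<Longrightarrow> u = v"
  by (rule fps_ext) (auto simp: agree_def)

lemma agree_tensor:
  assumes "agree n u u'" "agree n v v'"
  shows "agree n (u \<otimes>\<^sub>h v) (u' \<otimes>\<^sub>h v')"
  by (rule agree_trans[OF agree_h_linear[OF h_linear_tensor_left assms(1)]
        agree_h_linear[OF h_linear_tensor_right assms(2)]])

definition one_plus :: "nat \<Rightarrow> 'a::complex_algebra_1 fps \<Rightarrow> 'a fps"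
  where "one_plus n u = 1 + fps_X ^ n *\<^sub>h u"

lemma one_plus_nth: "one_plus n u $ m = 1 $ m + (if m < n then 0 else u $ (m - n))"
  by (simp only: one_plus_def fps_add_nth fps_scale_X_power)

lemma agree_one_plus: "agree n 1 (one_plus n u)"
  by (simp add: agree_def one_plus_nth)

text \<open>Writing a series that is 1 modulo \<open>h\<^sup>n\<close> as \<open>1 + h\<^sup>n u\<close> lets every
  \<open>\<complex>[[h]]\<close>-algebra homomorphism act on \<open>u\<close> alone, whose constant term is the leading
  coefficient.\<close>

lemma agree_one_obtain:
  assumes "agree n 1 t" "n > 0"
  obtains u where "t = one_plus n u" "u $ 0 = t $ n"
proof
  show "t = one_plus n (fps_shift n t)"
  proof (rule fps_ext)
    fix m
    show "t $ m = one_plus n (fps_shift n t) $ m"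
      using assms by (cases "m < n") (auto simp: agree_def one_plus_nth)
  qed
qed simp

lemma one_plus_hom: "h_algebra_hom F \<Longrightarrow> F (one_plus n u) = one_plus n (F u)"
  by (simp add: one_plus_def h_algebra_hom_linear h_linear_add h_linear_scale h_algebra_hom_one)

lemma one_plus_mult_left: "(one_plus n u * t) $ m = t $ m + (if m < n then 0 else (u * t) $ (m - n))"
  by (simp only: one_plus_def distrib_right fps_scale_mult_left fps_add_nth fps_scale_X_power mult_1_left)

lemma one_plus_mult_right: "(t * one_plus n u) $ m = t $ m + (if m < n then 0 else (t * u) $ (m - n))"
  by (simp only: one_plus_def distrib_left fps_scale_mult_right fps_add_nth fps_scale_X_power mult_1_right)

lemma central_one_plus:
  assumes "central x"
  shows "central (one_plus n (fps_const x))"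
proof -
  have "fps_const x * a = a * fps_const x" for a
    by (rule fps_ext) (simp add: centralD[OF assms])
  then show ?thesis
    by (simp add: central_def fps_eq_iff one_plus_mult_left one_plus_mult_right)
qed


section \<open>Symmetric invariant cocycles of a deformation\<close>

definition symmetric_cocycle ::
    "('g::complex_lie_algebra uea fps \<Rightarrow> ('g uea \<otimes> 'g uea) fps) \<Rightarrow> ('g uea \<otimes> 'g uea) fps
      \<Rightarrow> ('g uea \<otimes> 'g uea) fps \<Rightarrow> bool"
  where "symmetric_cocycle \<Delta> R E \<longleftrightarrow> E $ 0 = 1 \<and> (\<forall>a. E * \<Delta> a = \<Delta> a * E) \<and>
    R * E = fps_apply tensor_flip E * R \<and>
    fps_apply tensor_assoc ((E \<otimes>\<^sub>h 1) * fps_tensor_map \<Delta> (\<lambda>x. x) E)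
      = (1 \<otimes>\<^sub>h E) * fps_tensor_map (\<lambda>x. x) \<Delta> E"

lemma
  assumes "quasitriangular_deformation \<Delta> R"
  shows deformation_hom: "h_algebra_hom \<Delta>"
    and deformation_coassociative:
      "fps_apply tensor_assoc (fps_tensor_map \<Delta> (\<lambda>x. x) (\<Delta> a)) = fps_tensor_map (\<lambda>x. x) \<Delta> (\<Delta> a)"
    and deformation_R: "R * \<Delta> a = fps_apply tensor_flip (\<Delta> a) * R"
    and deformation_coproduct_nth_0: "\<Delta> a $ 0 = uea_coproduct (a $ 0)"
    and deformation_R_nth_0: "R $ 0 = 1"
  using assms
  by (simp_all add: quasitriangular_deformation_def h_bialgebra_def universal_R_matrix_def)

text \<open>The factor \<open>k \<otimes> k\<close> is central and symmetric, and \<open>\<Delta>(c)\<close> is central in the image of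
  \<open>\<Delta>\<close>, which settles invariance and symmetry.  In the cocycle identity, \<open>\<Delta>(c) \<otimes> 1\<close>
  is the image of the central element \<open>c \<otimes> 1\<close> under \<open>\<Delta> \<otimes> \<iota>\<close>, so it can be moved next to
  \<open>\<Delta>(k) \<otimes> k\<close>, where it cancels; either side is then multiplied by
  the iterated coproduct of \<open>c\<close> and by \<open>k \<otimes> k \<otimes> k\<close>.\<close>

lemma symmetric_cocycle_gauge:
  fixes \<Delta> :: "'g::complex_lie_algebra uea fps \<Rightarrow> ('g uea \<otimes> 'g uea) fps"
  assumes qt: "quasitriangular_deformation \<Delta> R" and E: "symmetric_cocycle \<Delta> R E"
    and c: "central c" "c $ 0 = 1" and k: "central k" "k $ 0 = 1" "c * k = 1"
  shows "symmetric_cocycle \<Delta> R (E * \<Delta> c * (k \<otimes>\<^sub>h k))"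
proof -
  let ?K = "k \<otimes>\<^sub>h k" and ?A = "fps_apply tensor_assoc" and ?F = "fps_apply tensor_flip"
    and ?D1 = "fps_tensor_map \<Delta> (\<lambda>x. x)" and ?D2 = "fps_tensor_map (\<lambda>x. x) \<Delta>"
  have E: "E $ 0 = 1" and Einv: "\<And>a. E * \<Delta> a = \<Delta> a * E" and Esym: "R * E = ?F E * R"
    and Ecoc: "?A ((E \<otimes>\<^sub>h 1) * ?D1 E) = (1 \<otimes>\<^sub>h E) * ?D2 E"
    using E by (simp_all add: symmetric_cocycle_def)
  note D = deformation_hom[OF qt]
  note D1 = h_algebra_hom_fps_tensor_map[OF D h_algebra_hom_ident]
    and D2 = h_algebra_hom_fps_tensor_map[OF h_algebra_hom_ident D]
  note Dt = fps_tensor_map_tensor[OF h_algebra_hom_linear[OF D] h_linear_ident]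
    fps_tensor_map_tensor[OF h_linear_ident h_algebra_hom_linear[OF D]]
  note A = h_algebra_hom_fps_apply[OF algebra_hom_tensor_assoc]
    and F = h_algebra_hom_fps_apply[OF algebra_hom_tensor_flip]
  note K = central_fps_tensor[OF k(1) k(1)]
  note comm_c = centralD[OF c(1)]
  have inv: "\<Delta> c * \<Delta> k = 1"
    by (simp add: h_algebra_hom_mult[OF D, symmetric] k(3) h_algebra_hom_one[OF D])
  have DD: "\<Delta> c * \<Delta> a = \<Delta> a * \<Delta> c" for a
    by (simp add: h_algebra_hom_mult[OF D, symmetric] comm_c)
  show ?thesis
    unfolding symmetric_cocycle_def
  proof (intro conjI allI)
    show "(E * \<Delta> c * ?K) $ 0 = 1"
      using E c k by (simp add: deformation_coproduct_nth_0[OF qt] uea_coproduct_one fps_tensor_nth_0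
          flip: one_tensor_def)
    show "E * \<Delta> c * ?K * \<Delta> a = \<Delta> a * (E * \<Delta> c * ?K)" for a
    proof -
      have "E * \<Delta> c * ?K * \<Delta> a = E * (\<Delta> c * \<Delta> a) * ?K"
        by (simp add: mult.assoc centralD[OF K])
      also have "\<dots> = (E * \<Delta> a) * \<Delta> c * ?K"
        by (simp add: DD mult.assoc)
      also have "\<dots> = \<Delta> a * (E * \<Delta> c * ?K)"
        by (simp only: Einv mult.assoc)
      finally show ?thesis .
    qed
    have "?F (E * \<Delta> c * ?K) * R = ?F E * ?F (\<Delta> c) * (?K * R)"
      by (simp add: h_algebra_hom_mult[OF F] fps_flip_tensor mult.assoc)
    also have "\<dots> = ?F E * (?F (\<Delta> c) * R) * ?K"
      by (simp add: centralD[OF K] mult.assoc)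
    also have "\<dots> = (?F E * R) * \<Delta> c * ?K"
      by (simp add: deformation_R[OF qt, symmetric] mult.assoc)
    also have "\<dots> = R * (E * \<Delta> c * ?K)"
      by (simp only: Esym[symmetric] mult.assoc)
    finally show "R * (E * \<Delta> c * ?K) = ?F (E * \<Delta> c * ?K) * R" ..
    have c1: "central (c \<otimes>\<^sub>h (1 :: 'g uea fps))" and c2: "central ((1 :: 'g uea fps) \<otimes>\<^sub>h c)"
      and K1: "central (?K \<otimes>\<^sub>h (1 :: 'g uea fps))" and K2: "central ((1 :: 'g uea fps) \<otimes>\<^sub>h ?K)"
      by (intro central_fps_tensor c(1) central_one K)+
    have 1: "(\<Delta> c \<otimes>\<^sub>h 1) * ?D1 t = ?D1 t * (\<Delta> c \<otimes>\<^sub>h 1)"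
      for t :: "('g uea \<otimes> 'g uea) fps"
      using arg_cong[OF centralD[OF c1, of t], of ?D1] by (simp add: h_algebra_hom_mult[OF D1] Dt)
    have 2: "(1 \<otimes>\<^sub>h \<Delta> c) * ?D2 t = ?D2 t * (1 \<otimes>\<^sub>h \<Delta> c)"
      for t :: "('g uea \<otimes> 'g uea) fps"
      using arg_cong[OF centralD[OF c2, of t], of ?D2] by (simp add: h_algebra_hom_mult[OF D2] Dt)
    have "((E * \<Delta> c * ?K) \<otimes>\<^sub>h 1) * ?D1 (E * \<Delta> c * ?K)
        = (E \<otimes>\<^sub>h 1) * (\<Delta> c \<otimes>\<^sub>h 1) * (?K \<otimes>\<^sub>h 1) * (?D1 E * ?D1 (\<Delta> c) * (\<Delta> k \<otimes>\<^sub>h k))"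
      by (simp add: h_algebra_hom_mult[OF D1] Dt fps_tensor_mult)
    also have "\<dots> = (E \<otimes>\<^sub>h 1) * ((\<Delta> c \<otimes>\<^sub>h 1) * (?D1 E * ?D1 (\<Delta> c))) * ((\<Delta> k \<otimes>\<^sub>h k) * (?K \<otimes>\<^sub>h 1))"
      by (simp add: mult.assoc centralD[OF K1])
    also have "(\<Delta> c \<otimes>\<^sub>h 1) * (?D1 E * ?D1 (\<Delta> c)) = ?D1 E * ?D1 (\<Delta> c) * (\<Delta> c \<otimes>\<^sub>h 1)"
      using 1[of "E * \<Delta> c"] by (simp add: h_algebra_hom_mult[OF D1])
    also have "(E \<otimes>\<^sub>h 1) * (?D1 E * ?D1 (\<Delta> c) * (\<Delta> c \<otimes>\<^sub>h 1)) * ((\<Delta> k \<otimes>\<^sub>h k) * (?K \<otimes>\<^sub>h 1))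
        = (E \<otimes>\<^sub>h 1) * ?D1 E * ?D1 (\<Delta> c) * (((\<Delta> c \<otimes>\<^sub>h 1) * (\<Delta> k \<otimes>\<^sub>h k)) * (?K \<otimes>\<^sub>h 1))"
      by (simp add: mult.assoc)
    also have "((\<Delta> c \<otimes>\<^sub>h 1) * (\<Delta> k \<otimes>\<^sub>h k)) * (?K \<otimes>\<^sub>h 1) = ?K \<otimes>\<^sub>h k"
      by (simp add: fps_tensor_mult inv)
    finally have l: "?A (((E * \<Delta> c * ?K) \<otimes>\<^sub>h 1) * ?D1 (E * \<Delta> c * ?K))
        = ?A ((E \<otimes>\<^sub>h 1) * ?D1 E) * ?D2 (\<Delta> c) * (k \<otimes>\<^sub>h ?K)"
      by (simp add: h_algebra_hom_mult[OF A] deformation_coassociative[OF qt] fps_assoc_tensor)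
    have "(1 \<otimes>\<^sub>h (E * \<Delta> c * ?K)) * ?D2 (E * \<Delta> c * ?K)
        = (1 \<otimes>\<^sub>h E) * (1 \<otimes>\<^sub>h \<Delta> c) * (1 \<otimes>\<^sub>h ?K) * (?D2 E * ?D2 (\<Delta> c) * (k \<otimes>\<^sub>h \<Delta> k))"
      by (simp add: h_algebra_hom_mult[OF D2] Dt fps_tensor_mult)
    also have "\<dots> = (1 \<otimes>\<^sub>h E) * ((1 \<otimes>\<^sub>h \<Delta> c) * (?D2 E * ?D2 (\<Delta> c))) * ((k \<otimes>\<^sub>h \<Delta> k) * (1 \<otimes>\<^sub>h ?K))"
      by (simp add: mult.assoc centralD[OF K2])
    also have "(1 \<otimes>\<^sub>h \<Delta> c) * (?D2 E * ?D2 (\<Delta> c)) = ?D2 E * ?D2 (\<Delta> c) * (1 \<otimes>\<^sub>h \<Delta> c)"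
      using 2[of "E * \<Delta> c"] by (simp add: h_algebra_hom_mult[OF D2])
    also have "(1 \<otimes>\<^sub>h E) * (?D2 E * ?D2 (\<Delta> c) * (1 \<otimes>\<^sub>h \<Delta> c)) * ((k \<otimes>\<^sub>h \<Delta> k) * (1 \<otimes>\<^sub>h ?K))
        = (1 \<otimes>\<^sub>h E) * ?D2 E * ?D2 (\<Delta> c) * (((1 \<otimes>\<^sub>h \<Delta> c) * (k \<otimes>\<^sub>h \<Delta> k)) * (1 \<otimes>\<^sub>h ?K))"
      by (simp add: mult.assoc)
    also have "((1 \<otimes>\<^sub>h \<Delta> c) * (k \<otimes>\<^sub>h \<Delta> k)) * (1 \<otimes>\<^sub>h ?K) = k \<otimes>\<^sub>h ?K"
      by (simp add: fps_tensor_mult inv)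
    finally have r: "(1 \<otimes>\<^sub>h (E * \<Delta> c * ?K)) * ?D2 (E * \<Delta> c * ?K)
        = (1 \<otimes>\<^sub>h E) * ?D2 E * ?D2 (\<Delta> c) * (k \<otimes>\<^sub>h ?K)" .
    show "?A (((E * \<Delta> c * ?K) \<otimes>\<^sub>h 1) * ?D1 (E * \<Delta> c * ?K))
        = (1 \<otimes>\<^sub>h (E * \<Delta> c * ?K)) * ?D2 (E * \<Delta> c * ?K)"
      by (simp only: l r Ecoc)
  qed
qed

lemma fps_tensor_map_nth_0:
  assumes F: "h_linear F" and G: "h_linear G" and f: "clinear f" and g: "clinear g"
    and Ff: "\<And>v. F v $ 0 = f (v $ 0)" and Gg: "\<And>w. G w $ 0 = g (w $ 0)"
  shows "fps_tensor_map F G t $ 0 = tensor_map f g (t $ 0)"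
proof -
  note B = cbilinear_fps_tensor_map[OF F G]
  have "tensor_lift (\<lambda>v w. F (fps_const v) \<otimes>\<^sub>h G (fps_const w)) s $ 0 = tensor_map f g s" for s
    by (rule tensor_lift_unique[OF clinear_compose[OF clinear_tensor_lift[OF B] clinear_fps_nth]
          clinear_tensor_map[OF f g]])
      (simp add: tensor_lift_tensor[OF B] tensor_map_tensor[OF f g] fps_tensor_nth_0 Ff Gg)
  then show ?thesis
    by (simp add: fps_tensor_map_def)
qed

text \<open>To first nontrivial order products become sums, \<open>\<Delta>\<close> becomes the undeformed coproduct, and
  \<open>R\<close>, being 1 modulo \<open>h\<close>, drops out of the symmetry condition.\<close>

lemma symmetric_cocycle_leading_coefficient:
  fixes \<Delta> :: "'g::complex_lie_algebra uea fps \<Rightarrow> ('g uea \<otimes> 'g uea) fps"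
  assumes qt: "quasitriangular_deformation \<Delta> R" and E: "symmetric_cocycle \<Delta> R E"
    and n: "n > 0" and agree: "agree n 1 E"
  shows "uea_cocycle (E $ n)" "tensor_flip (E $ n) = E $ n"
    "E $ n * uea_coproduct a = uea_coproduct a * E $ n"
proof -
  note E = E[unfolded symmetric_cocycle_def]
  note D = deformation_hom[OF qt]
  note D1 = h_algebra_hom_fps_tensor_map[OF D h_algebra_hom_ident]
    and D2 = h_algebra_hom_fps_tensor_map[OF h_algebra_hom_ident D]
  obtain u where u: "E = one_plus n u" "u $ 0 = E $ n"
    using agree_one_obtain[OF agree n] .
  have prod: "(one_plus n s * one_plus n t) $ n = s $ 0 + t $ 0"
    for s t :: "'c::complex_algebra_1 fps"
    using n by (simp add: one_plus_mult_left one_plus_nth)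
  note D0 = fps_tensor_map_nth_0[OF h_algebra_hom_linear[OF D] h_linear_ident clinear_uea_coproduct
      clinear_ident deformation_coproduct_nth_0[OF qt] refl]
    fps_tensor_map_nth_0[OF h_linear_ident h_algebra_hom_linear[OF D] clinear_ident
      clinear_uea_coproduct refl deformation_coproduct_nth_0[OF qt]]
  have "fps_apply tensor_assoc ((E \<otimes>\<^sub>h 1) * fps_tensor_map \<Delta> (\<lambda>x. x) E) $ n
      = tensor_assoc (E $ n \<otimes> 1 + tensor_map uea_coproduct (\<lambda>x. x) (E $ n))"
    unfolding u(1) one_plus_hom[OF D1] one_plus_hom[OF h_algebra_hom_leg1]
    by (simp add: fps_apply_def prod fps_tensor_nth_0 D0 u(2)[unfolded u(1)])
  moreover have "((1 \<otimes>\<^sub>h E) * fps_tensor_map (\<lambda>x. x) \<Delta> E) $ n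
      = 1 \<otimes> E $ n + tensor_map (\<lambda>x. x) uea_coproduct (E $ n)"
    unfolding u(1) one_plus_hom[OF D2] one_plus_hom[OF h_algebra_hom_leg2]
    by (simp add: prod fps_tensor_nth_0 D0 u(2)[unfolded u(1)])
  ultimately show "uea_cocycle (E $ n)"
    using E by (simp add: uea_cocycle_def clinear_add[OF clinear_tensor_assoc])
  have "(R * E) $ n = R $ n + E $ n"
    unfolding u(1) by (simp add: one_plus_mult_right deformation_R_nth_0[OF qt] u(2)[unfolded u(1)])
  moreover have "(fps_apply tensor_flip E * R) $ n = R $ n + tensor_flip (E $ n)"
    unfolding u(1) one_plus_hom[OF h_algebra_hom_fps_apply[OF algebra_hom_tensor_flip]]
    by (simp add: one_plus_mult_left deformation_R_nth_0[OF qt] fps_apply_def u(2)[unfolded u(1)])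
  ultimately show "tensor_flip (E $ n) = E $ n"
    using E by simp
  have "(E * \<Delta> (fps_const a)) $ n = (\<Delta> (fps_const a) * E) $ n"
    using E by simp
  then show "E $ n * uea_coproduct a = uea_coproduct a * E $ n"
    unfolding u(1)
    by (simp add: one_plus_mult_left one_plus_mult_right deformation_coproduct_nth_0[OF qt] u(2)[unfolded u(1)])
qed

lemma symmetric_cocycle_improve:
  fixes \<Delta> :: "'g::complex_lie_algebra uea fps \<Rightarrow> ('g uea \<otimes> 'g uea) fps"
  assumes qt: "quasitriangular_deformation \<Delta> R" and E: "symmetric_cocycle \<Delta> R E"
    and n: "n > 0" and agree: "agree n 1 E"
  shows "\<exists>y. central y \<and> agree n 1 y \<and> agree (Suc n) (E * \<Delta> y) (y \<otimes>\<^sub>h y)"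
proof -
  obtain x where x: "central x" "E $ n = uea_coboundary x"
    using symmetric_invariant_cocycle_is_coboundary[OF symmetric_cocycle_leading_coefficient[OF assms]]
    by blast
  let ?x = "fps_const x"
  obtain u where u: "E = one_plus n u" "u $ 0 = E $ n"
    using agree_one_obtain[OF agree n] .
  have prod: "(one_plus n s * one_plus n t) $ m = 1 $ m + (if m = n then s $ 0 + t $ 0 else 0)"
    if "m < Suc n" for s t :: "('g uea \<otimes> 'g uea) fps" and m
    using n that by (auto simp: one_plus_mult_left one_plus_nth)
  have 1: "E * \<Delta> (one_plus n ?x) = one_plus n u * one_plus n (\<Delta> ?x)"
    by (simp only: u(1) one_plus_hom[OF deformation_hom[OF qt]])
  have "one_plus n ?x \<otimes>\<^sub>h one_plus n ?x = (one_plus n ?x \<otimes>\<^sub>h 1) * (1 \<otimes>\<^sub>h one_plus n ?x)"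
    by (simp add: fps_tensor_mult)
  then have 2: "one_plus n ?x \<otimes>\<^sub>h one_plus n ?x = one_plus n (?x \<otimes>\<^sub>h 1) * one_plus n (1 \<otimes>\<^sub>h ?x)"
    by (simp only: one_plus_hom[OF h_algebra_hom_leg1] one_plus_hom[OF h_algebra_hom_leg2])
  have "agree (Suc n) (E * \<Delta> (one_plus n ?x)) (one_plus n ?x \<otimes>\<^sub>h one_plus n ?x)"
    by (simp add: agree_def 1 2 prod u(2) x(2) uea_coboundary_def deformation_coproduct_nth_0[OF qt]
        fps_tensor_nth_0)
  then show ?thesis
    using central_one_plus[OF x(1)] agree_one_plus by blast
qed

lemma trivialization_step:
  fixes \<Delta> :: "'g::complex_lie_algebra uea fps \<Rightarrow> ('g uea \<otimes> 'g uea) fps"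
  assumes qt: "quasitriangular_deformation \<Delta> R" and E: "symmetric_cocycle \<Delta> R E" and n: "n > 0"
    and c: "central c" "c $ 0 = 1" "agree n (E * \<Delta> c) (c \<otimes>\<^sub>h c)"
  shows "\<exists>c'. central c' \<and> agree n c c' \<and> agree (Suc n) (E * \<Delta> c') (c' \<otimes>\<^sub>h c')"
proof -
  obtain k where k: "central k" "k $ 0 = 1" "c * k = 1" "k * c = 1"
    using central_inverse[OF c(1,2)] .
  let ?E = "E * \<Delta> c * (k \<otimes>\<^sub>h k)"
  note sc = symmetric_cocycle_gauge[OF qt E c(1,2) k(1-3)]
  have "agree n ((c \<otimes>\<^sub>h c) * (k \<otimes>\<^sub>h k)) ?E"
    by (rule agree_h_linear[OF h_linear_mult_right agree_sym[OF c(3)]])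
  then have "agree n 1 ?E"
    by (simp add: fps_tensor_mult k(3) fps_tensor_one)
  then obtain y where y: "central y" "agree n 1 y" "agree (Suc n) (?E * \<Delta> y) (y \<otimes>\<^sub>h y)"
    using symmetric_cocycle_improve[OF qt sc n] by blast
  note cc = central_fps_tensor[OF c(1) c(1)]
  have "?E * \<Delta> y * (c \<otimes>\<^sub>h c) = E * \<Delta> c * ((k \<otimes>\<^sub>h k) * (c \<otimes>\<^sub>h c)) * \<Delta> y"
    by (simp add: mult.assoc centralD[OF cc])
  also have "\<dots> = E * \<Delta> (c * y)"
    by (simp add: fps_tensor_mult k(4) fps_tensor_one h_algebra_hom_mult[OF deformation_hom[OF qt]] mult.assoc)
  finally have "agree (Suc n) (E * \<Delta> (c * y)) ((c * y) \<otimes>\<^sub>h (c * y))"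
    using agree_h_linear[OF h_linear_mult_right[of "c \<otimes>\<^sub>h c"] y(3)]
    by (simp add: fps_tensor_mult centralD[OF c(1)])
  moreover have "agree n c (c * y)"
    using agree_h_linear[OF h_linear_mult_left[of c] y(2)] by simp
  ultimately show ?thesis
    using central_mult[OF c(1) y(1)] by blast
qed

text \<open>The approximations \<open>C n\<close> stabilize \<open>h\<close>-adically, and all operations in the equation for
  \<open>c\<close> are \<open>\<complex>[[h]]\<close>-linear in each argument, hence continuous.\<close>

lemma trivializing_element:
  fixes \<Delta> :: "'g::complex_lie_algebra uea fps \<Rightarrow> ('g uea \<otimes> 'g uea) fps"
  assumes qt: "quasitriangular_deformation \<Delta> R" and E: "symmetric_cocycle \<Delta> R E"
  shows "\<exists>c. central c \<and> c $ 0 = 1 \<and> E * \<Delta> c = c \<otimes>\<^sub>h c"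
proof -
  note D = deformation_hom[OF qt]
  let ?P = "\<lambda>n c. central c \<and> c $ 0 = 1 \<and> agree (Suc n) (E * \<Delta> c) (c \<otimes>\<^sub>h c)"
  have "\<exists>C. \<forall>n. ?P n (C n) \<and> agree (Suc n) (C n) (C (Suc n))"
  proof (rule dependent_nat_choice)
    have "?P 0 1"
      using E by (simp add: agree_def symmetric_cocycle_def central_one h_algebra_hom_one[OF D]
          fps_tensor_one)
    then show "\<exists>c. ?P 0 c" by blast
    fix c n
    assume "?P n c"
    then obtain c' where c': "central c'" "agree (Suc n) c c'"
      "agree (Suc (Suc n)) (E * \<Delta> c') (c' \<otimes>\<^sub>h c')"
      using trivialization_step[OF qt E, of "Suc n" c] by blast
    then have "c' $ 0 = 1"
      using \<open>?P n c\<close> by (auto simp: agree_def)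
    with c' show "\<exists>c'. ?P (Suc n) c' \<and> agree (Suc n) c c'" by blast
  qed
  then obtain C where C: "\<And>n. ?P n (C n)" "\<And>n. agree (Suc n) (C n) (C (Suc n))" by blast
  define c where "c = Abs_fps (\<lambda>n. C n $ n)"
  have "agree (Suc n) (C n) (C (n + m))" for n m
  proof (induction m)
    case (Suc m)
    show ?case
      using agree_trans[OF Suc agree_mono[OF C(2)[of "n + m"]]] by simp
  qed (simp add: agree_def)
  note steps = this
  have agree: "agree (Suc n) c (C n)" for n
    unfolding agree_def
  proof (intro allI impI)
    fix m assume "m < Suc n"
    then show "c $ m = C n $ m"
      using steps[of m "n - m"] by (simp add: agree_def c_def)
  qed
  have "c * a = a * c" for a
  proof (rule agree_all)
    fix n
    have "agree (Suc n) (c * a) (C n * a)"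
      by (rule agree_h_linear[OF h_linear_mult_right agree])
    moreover have "agree (Suc n) (a * C n) (a * c)"
      by (rule agree_h_linear[OF h_linear_mult_left agree_sym[OF agree]])
    moreover have "C n * a = a * C n"
      using C(1) centralD by blast
    ultimately have "agree (Suc n) (c * a) (a * c)"
      using agree_trans by metis
    then show "agree n (c * a) (a * c)" by (rule agree_mono) simp
  qed
  moreover have "c $ 0 = 1"
    using C(1)[of 0] by (simp add: c_def)
  moreover have "E * \<Delta> c = c \<otimes>\<^sub>h c"
  proof (rule agree_all)
    fix n
    have "agree (Suc n) (E * \<Delta> c) (E * \<Delta> (C n))"
      by (rule agree_h_linear[OF h_linear_compose[OF h_algebra_hom_linear[OF D] h_linear_mult_left] agree])
    moreover have "agree (Suc n) (E * \<Delta> (C n)) (C n \<otimes>\<^sub>h C n)"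
      using C(1) by blast
    moreover have "agree (Suc n) (C n \<otimes>\<^sub>h C n) (c \<otimes>\<^sub>h c)"
      by (rule agree_sym[OF agree_tensor[OF agree agree]])
    ultimately have "agree (Suc n) (E * \<Delta> c) (c \<otimes>\<^sub>h c)"
      using agree_trans by blast
    then show "agree n (E * \<Delta> c) (c \<otimes>\<^sub>h c)" by (rule agree_mono) simp
  qed
  ultimately show ?thesis
    by (auto simp: central_def)
qed

theorem theoremB1:
  fixes \<Delta> :: "'g::complex_lie_algebra uea fps \<Rightarrow> ('g uea \<otimes> 'g uea) fps"
    and R E :: "('g uea \<otimes> 'g uea) fps"
  assumes "finite_dimensional TYPE('g)" and "semisimple TYPE('g)"
    and "quasitriangular_deformation \<Delta> R"
    and "E $ 0 = 1"
    and invariant: "\<And>a. E * \<Delta> a - \<Delta> a * E = 0"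
    and symmetric: "R * E = fps_apply tensor_flip E * R"
    and cocycle: "fps_apply tensor_assoc ((E \<otimes>\<^sub>h 1) * fps_tensor_map \<Delta> (\<lambda>x. x) E)
      = (1 \<otimes>\<^sub>h E) * fps_tensor_map (\<lambda>x. x) \<Delta> E"
  shows "\<exists>c d. (\<forall>a. c * a = a * c) \<and> c $ 0 = 1 \<and>
    \<Delta> c * d = 1 \<and> d * \<Delta> c = 1 \<and> E = (c \<otimes>\<^sub>h c) * d"
proof -
  have "symmetric_cocycle \<Delta> R E"
    using assms(4) invariant symmetric cocycle by (simp add: symmetric_cocycle_def)
  then obtain c where c: "central c" "c $ 0 = 1" "E * \<Delta> c = c \<otimes>\<^sub>h c"
    using trivializing_element[OF assms(3)] by blast
  obtain k where k: "c * k = 1" "k * c = 1"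
    using central_inverse[OF c(1,2)] .
  have "\<Delta> c * \<Delta> k = 1" "\<Delta> k * \<Delta> c = 1"
    using h_algebra_hom_mult[OF deformation_hom[OF assms(3)]] h_algebra_hom_one[OF deformation_hom[OF assms(3)]]
    by (simp_all add: k flip: h_algebra_hom_mult[OF deformation_hom[OF assms(3)]])
  moreover from this have "E = (c \<otimes>\<^sub>h c) * \<Delta> k"
    by (simp add: c(3)[symmetric] mult.assoc)
  ultimately show ?thesis
    using c(1,2) centralD by blast
qed

end
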